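(* Let $p\in\left]1,+\infty\right[$, let $Y$ be a separable Hilbert space with norm $\|\cdot\|_Y$, let $y\in Y$ and let $A:X\to Y$ be a bounded linear operator. Let $\mathcal I=\{I_k\}_{k\in\mathcal N}$ be a family of bounded closed intervals of $\mathbb R$ such that there exists $\omega>0$ with $[-\omega,\omega]\subset I_k$ for all $k\in\mathcal N$. Let $h(x)=\frac12\|Ax-y\|_Y^2$, let $L\in\left]0,+\infty\right[$ be such that $\nabla h$ is $L$-Lipschitz continuous, let $g(x)=\|x\|_{1,\mathcal I}+\frac1p\|x\|_p^p$ and $f=g+h$ on $X$. Let $(x^n)_{n\in\mathbb N}$ be the sequence generated by the Forward-Backward algorithm applied to $f$: $$x^0\in X,\quad\lambda\in\left]0,2L^{-1}\right[,\quad x^{n+1}=\operatorname{prox}_{\lambda g}\big(x^n-\lambda\nabla h(x^n)\big).$$ Then $(x^n)_{n\in\mathbb N}$ converges strongly to some $\bar x\in\operatorname{argmin}f$. If $p\in\left]1,2\right[$, there exist two constants $\varepsilon\in\left]0,1\right[$ and $C\in\left]0,+\infty\right[$, depending on $(\lambda,L,x^0,\mathcal I,A,y,p)$, such that for all $n\ge1$, $$f(x^n)-\inf f\le\varepsilon^n\big(f(x^0)-\inf f\big)\quad\text{and}\quad\|x^{n+1}-\bar x\|\le C\sqrt{\varepsilon}^{\,n}.$$ If $p\in\left]2,+\infty\right[$, there exist two constants $(C_1,C_2)\in\left]0,+\infty\right[^2$, depending on $(\lambda,L,x^0,\mathcal I,A,y,p)$, such that for all $n\ge1$, $$f(x^n)-\inf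 f\le C_1\,n^{-\frac p{p-2}}\quad\text{and}\quad\|x^{n+1}-\bar x\|\le C_2\,n^{-\frac1{p-2}}.$$
   Context: $X$ is a real separable Hilbert space with inner product $\langle\cdot,\cdot\rangle$ and norm $\|\cdot\|$; $\mathcal N\subset\mathbb N$ and $(e_k)_{k\in\mathcal N}$ is an orthonormal basis of $X$; for $x\in X$, $x_k=\langle x,e_k\rangle$. $\|x\|_{1,\mathcal I}=\sum_{k\in\mathcal N}\sigma_{I_k}(x_k)\in\mathbb R\cup\{+\infty\}$, where $\sigma_I(t)=\sup_{s\in I}st$ is the support function of $I$, and $\|x\|_p^p=\sum_{k\in\mathcal N}|x_k|^p$ (possibly $+\infty$). For a proper convex lower semicontinuous $g$ and $\lambda>0$, $\operatorname{prox}_{\lambda g}(x)$ is the unique minimizer of $y\mapsto g(y)+\frac1{2\lambda}\|y-x\|^2$. When $f(x^0)=+\infty$, the right-hand side $\varepsilon^n(f(x^0)-\inf f)$ is read as $+\infty$. *)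

theory Defs
  imports "HOL-Analysis.Analysis"
begin

text \<open>The index set may be finite or infinite, so this is a Hilbert (not a Hamel) basis.\<close>

definition orthonormal_basis :: "nat set \<Rightarrow> (nat \<Rightarrow> 'a::real_inner) \<Rightarrow> bool" where
  "orthonormal_basis N e \<longleftrightarrow>
     (\<forall>k\<in>N. norm (e k) = 1) \<and>
     pairwise (\<lambda>j k. e j \<bullet> e k = 0) N \<and>
     closure (span (e ` N)) = UNIV"

definition support_function :: "real set \<Rightarrow> real \<Rightarrow> ereal" where
  "support_function I t = (SUP s\<in>I. ereal (s * t))"

text \<open>
  The next two sums are unconditional sums in the extended reals.  The second always has
  nonnegative terms, and so does the first when \<open>0 \<in> I k\<close> for all \<open>k \<in> N\<close>; each sum is then the
  supremum of its finite partial sums, with value \<open>\<infinity>\<close> in case of divergence.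
\<close>

definition weighted_l1 ::
    "nat set \<Rightarrow> (nat \<Rightarrow> 'a::real_inner) \<Rightarrow> (nat \<Rightarrow> real set) \<Rightarrow> 'a \<Rightarrow> ereal" where
  "weighted_l1 N e I x = (\<Sum>\<^sub>\<infinity>k\<in>N. support_function (I k) (x \<bullet> e k))"

definition lp_norm_powr ::
    "nat set \<Rightarrow> (nat \<Rightarrow> 'a::real_inner) \<Rightarrow> real \<Rightarrow> 'a \<Rightarrow> ereal" where
  "lp_norm_powr N e p x = (\<Sum>\<^sub>\<infinity>k\<in>N. ereal (\<bar>x \<bullet> e k\<bar> powr p))"

definition argmin :: "('a \<Rightarrow> ereal) \<Rightarrow> 'a set" where
  "argmin f = {x. is_arg_min f (\<lambda>_. True) x}"

text \<open>
  Only meaningful where the minimizer exists and is unique, in particular for \<open>lam > 0\<close> and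
  proper, convex, lower semicontinuous \<open>g\<close> on a Hilbert space.
\<close>

definition prox :: "real \<Rightarrow> ('a::real_inner \<Rightarrow> ereal) \<Rightarrow> 'a \<Rightarrow> 'a" where
  "prox lam g x =
     (THE z. z \<in> argmin (\<lambda>y. g y + ereal (1 / (2 * lam) * (norm (y - x))\<^sup>2)))"

text \<open>Only meaningful at points of differentiability.\<close>

definition gradient :: "('a::real_inner \<Rightarrow> real) \<Rightarrow> 'a \<Rightarrow> 'a" where
  "gradient h x = (THE D. GDERIV h x :> D)"

end

theory Submission
  imports Defs
begin

text \<open>
  Write \<open>F = G + h\<close> for the finite part of the objective, where \<open>G\<close> is the sum over the coordinates
  of the penalties \<open>\<phi> k t = \<sigma> k t + \<bar>t\<bar> powr p / p\<close>, \<open>\<sigma> k\<close> is the support function of \<open>I k\<close>, and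
  \<open>\<sigma> k t \<ge> \<omega> * \<bar>t\<bar>\<close>.  The proof
  rests on one quantitative property of \<open>G\<close>: on each sublevel set,
  \<open>G ((x + u) / 2) + c * norm (x - u) powr q \<le> (G x + G u) / 2\<close> for some \<open>c > 0\<close>.

  The exponent \<open>q\<close> is obtained from the coordinates.  A sublevel set of \<open>G\<close> is bounded in the
  \<open>l1\<close> norm, because \<open>\<phi> k t \<ge> \<omega> * \<bar>t\<bar>\<close>.  For \<open>p \<le> 2\<close> the function \<open>\<bar>t\<bar> powr p\<close> is strongly convex on
  bounded intervals, which gives \<open>q = 2\<close>.  For \<open>p \<ge> 2\<close> Clarkson's inequality gives a gain
  proportional to the \<open>p\<close>-th power of the \<open>lp\<close> norm of \<open>x - u\<close>, and interpolation between \<open>l1\<close> and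
  \<open>lp\<close> turns it into \<open>q = 2 * (p - 1)\<close>.  When \<open>x - u\<close> is supported in a fixed finite set of
  coordinates, the better exponent \<open>q = p\<close> holds.

  This property survives the addition of a nonnegative continuous convex function.  It makes
  minimizing sequences Cauchy, so that minimizers of \<open>F\<close> and of the proximal problems exist
  and are unique (\<open>uniformly_midconvex_minimizer_exists\<close>), and it yields the growth estimate
  \<open>c * norm (x - xbar) powr q \<le> F x - F xbar\<close> around the minimizer \<open>xbar\<close>
  (\<open>uniformly_midconvex_growth\<close>).

  For the algorithm put \<open>gap n = F (x n) - F xbar\<close>.  The gap drops by at least a multiple of the
  squared step length, and \<open>gap (n + 1)\<close> is at most a multiple of the step length times the
  distance of \<open>x (n + 1)\<close> to \<open>xbar\<close>.  Together with growth of exponent \<open>q\<close> this gives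
  \<open>gap (n + 1) powr (2 - 2 / q) \<le> K * (gap n - gap (n + 1))\<close>, hence a linear rate for \<open>q = 2\<close> and the
  rate \<open>n powr - (q / (q - 2))\<close> for \<open>q > 2\<close>; growth transfers the rates to the iterates.

  For \<open>p > 2\<close> the argument is run twice.  The exponent \<open>2 * (p - 1)\<close> gives strong convergence with
  a suboptimal rate.  Strong convergence implies that the points at which the proximal map is
  evaluated have, from some index on, all but finitely many coordinates below the threshold
  \<open>lam * \<omega>\<close>; the proximal map annihilates these (\<open>finite_support_identification\<close>).  The iterates then
  live in a space of finite dimension, where the exponent \<open>q = p\<close> is available and gives the claimed
  rates.
\<close>

section \<open>Scalar inequalities for powers\<close>

lemma powr_add_le:
  fixes u v r :: real
  assumes "0 \<le> u" "0 \<le> v" "1 \<le> r"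
  shows "u powr r + v powr r \<le> (u + v) powr r"
proof (cases "u + v = 0")
  case True
  then have "u = 0" "v = 0" using assms by auto
  then show ?thesis by simp
next
  case False
  define w where "w = u + v"
  have w: "w > 0" using False assms unfolding w_def by linarith
  have *: "t powr r \<le> w powr r * (t / w)" if "0 \<le> t" "t \<le> w" for t
  proof -
    have "(t / w) powr r \<le> (t / w) powr 1"
    proof (cases "t = 0")
      case False
      then show ?thesis using that w assms by (intro powr_mono') auto
    qed simp
    then have "w powr r * (t / w) powr r \<le> w powr r * (t / w)"
      using that w by (intro mult_left_mono) auto
    then show ?thesis using that w by (simp add: powr_divide)
  qed
  have "u powr r + v powr r \<le> w powr r * (u / w) + w powr r * (v / w)"
    using *[of u] *[of v] assms by (intro add_mono) (auto simp: w_def)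
  also have "\<dots> = w powr r * ((u + v) / w)" by (simp add: algebra_simps add_divide_distrib)
  also have "\<dots> = (u + v) powr r" using w by (simp add: w_def)
  finally show ?thesis .
qed

lemma has_real_derivative_abs_powr:
  fixes p t :: real
  assumes "1 < p"
  shows "((\<lambda>t. \<bar>t\<bar> powr p) has_real_derivative p * sgn t * \<bar>t\<bar> powr (p - 1)) (at t)"
proof -
  consider "t > 0" | "t < 0" | "t = 0" by linarith
  then show ?thesis
  proof cases
    case 1
    have "((\<lambda>t. t powr p) has_real_derivative p * sgn t * \<bar>t\<bar> powr (p - 1)) (at t)"
      using 1 by (auto intro!: derivative_eq_intros)
    moreover have "eventually (\<lambda>s. s > 0) (nhds t)"
      using 1 eventually_nhds_in_open[of "{0<..}" t] by simp
    then have "eventually (\<lambda>s. \<bar>s\<bar> powr p = s powr p) (nhds t)"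
      by eventually_elim simp
    ultimately show ?thesis by (subst DERIV_cong_ev[OF refl _ refl])
  next
    case 2
    have "((\<lambda>t. (-t) powr p) has_real_derivative p * sgn t * \<bar>t\<bar> powr (p - 1)) (at t)"
      using 2 by (auto intro!: derivative_eq_intros)
    moreover have "eventually (\<lambda>s. s < 0) (nhds t)"
      using 2 eventually_nhds_in_open[of "{..<0}" t] by simp
    then have "eventually (\<lambda>s. \<bar>s\<bar> powr p = (-s) powr p) (nhds t)"
      by eventually_elim simp
    ultimately show ?thesis by (subst DERIV_cong_ev[OF refl _ refl])
  next
    case 3
    have "((\<lambda>h. \<bar>h\<bar> powr (p - 1)) \<longlongrightarrow> \<bar>0\<bar> powr (p - 1)) (at (0::real))"
      using assms by (intro tendsto_powr' tendsto_rabs tendsto_ident_at tendsto_const) auto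
    then have lim: "((\<lambda>h. \<bar>h\<bar> powr (p - 1)) \<longlongrightarrow> 0) (at (0::real))"
      by simp
    have "((\<lambda>h. \<bar>h\<bar> powr p / h) \<longlongrightarrow> 0) (at (0::real))"
    proof (rule Lim_null_comparison[OF _ lim], rule eventuallyI)
      fix h :: real
      show "norm (\<bar>h\<bar> powr p / h) \<le> \<bar>h\<bar> powr (p - 1)"
        by (cases "h = 0") (auto simp: powr_diff)
    qed
    then show ?thesis using 3 assms by (simp add: DERIV_def)
  qed
qed

lemma convex_on_abs_powr:
  fixes p :: real
  assumes "1 < p"
  shows "convex_on UNIV (\<lambda>t. \<bar>t\<bar> powr p)"
proof (rule convex_on_realI)
  fix s t :: real
  assume "s \<le> t"
  have "sgn s * \<bar>s\<bar> powr (p - 1) \<le> sgn t * \<bar>t\<bar> powr (p - 1)"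
  proof (cases "0 \<le> s \<or> t \<le> 0")
    case True
    then consider "s = 0" | "t = 0" | "0 < s" | "t < 0" by linarith
    then show ?thesis
    proof cases
      case 3
      then show ?thesis using \<open>s \<le> t\<close> assms by (simp add: powr_mono2)
    next
      case 4
      then show ?thesis using \<open>s \<le> t\<close> assms by (simp add: powr_mono2)
    qed (use \<open>s \<le> t\<close> in \<open>auto simp: sgn_if\<close>)
  next
    case False
    then have "sgn s * \<bar>s\<bar> powr (p - 1) \<le> 0" "0 \<le> sgn t * \<bar>t\<bar> powr (p - 1)" by auto
    then show ?thesis by linarith
  qed
  then have "p * (sgn s * \<bar>s\<bar> powr (p - 1)) \<le> p * (sgn t * \<bar>t\<bar> powr (p - 1))"
    using assms by (intro mult_left_mono) auto
  then show "p * sgn s * \<bar>s\<bar> powr (p - 1) \<le> p * sgn t * \<bar>t\<bar> powr (p - 1)"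
    by (simp add: mult.assoc)
qed (use has_real_derivative_abs_powr[OF assms] in auto)

text \<open>
  Clarkson's inequality for scalars.  The parallelogram law is the case \<open>p = 2\<close>; the general case
  follows from it by applying the superadditive and convex function \<open>s powr (p / 2)\<close> to squares.
\<close>
lemma powr_midpoint_clarkson:
  fixes a b p :: real
  assumes "2 \<le> p"
  shows "\<bar>(a + b) / 2\<bar> powr p + \<bar>(a - b) / 2\<bar> powr p \<le> (\<bar>a\<bar> powr p + \<bar>b\<bar> powr p) / 2"
proof -
  have sq: "(t\<^sup>2) powr (p / 2) = \<bar>t\<bar> powr p" for t :: real
  proof -
    have "(t\<^sup>2) powr (p / 2) = (\<bar>t\<bar> powr 2) powr (p / 2)"
      by simp
    also have "\<dots> = \<bar>t\<bar> powr p" by (subst powr_powr) simp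
    finally show ?thesis .
  qed
  have "\<bar>(a + b) / 2\<bar> powr p + \<bar>(a - b) / 2\<bar> powr p
      = (((a + b) / 2)\<^sup>2) powr (p / 2) + (((a - b) / 2)\<^sup>2) powr (p / 2)"
    by (simp only: sq)
  also have "\<dots> \<le> (((a + b) / 2)\<^sup>2 + ((a - b) / 2)\<^sup>2) powr (p / 2)"
    using assms by (intro powr_add_le) auto
  also have "((a + b) / 2)\<^sup>2 + ((a - b) / 2)\<^sup>2 = (a\<^sup>2 + b\<^sup>2) / 2"
    by (simp add: power2_eq_square field_simps)
  also have "((a\<^sup>2 + b\<^sup>2) / 2) powr (p / 2) \<le> ((a\<^sup>2) powr (p / 2) + (b\<^sup>2) powr (p / 2)) / 2"
  proof (cases "p = 2")
    case False
    then have "\<bar>(1 - 1 / 2) *\<^sub>R a\<^sup>2 + (1 / 2) *\<^sub>R b\<^sup>2\<bar> powr (p / 2)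
      \<le> (1 - 1 / 2) * \<bar>a\<^sup>2\<bar> powr (p / 2) + (1 / 2) * \<bar>b\<^sup>2\<bar> powr (p / 2)"
      using assms by (intro convex_onD[OF convex_on_abs_powr]) auto
    moreover have "\<bar>(1 - 1 / 2) *\<^sub>R a\<^sup>2 + (1 / 2) *\<^sub>R b\<^sup>2\<bar> = (a\<^sup>2 + b\<^sup>2) / 2"
      by (simp add: field_simps)
    ultimately show ?thesis by (simp add: add_divide_distrib)
  qed simp
  also have "\<dots> = (\<bar>a\<bar> powr p + \<bar>b\<bar> powr p) / 2"
    by (simp add: sq)
  finally show ?thesis .
qed

text \<open>
  For \<open>p \<le> 2\<close> the second derivative \<open>p * (p - 1) * \<bar>t\<bar> powr (p - 2)\<close> is smallest at the end points of
  \<open>{- R..R}\<close>, so subtracting half of this minimum times \<open>t\<^sup>2\<close> leaves a convex function.  Since the second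
  derivative blows up at \<open>0\<close> when \<open>p < 2\<close>, convexity is derived from the monotonicity of the first
  derivative, which is odd, so that only \<open>t \<ge> 0\<close> needs computation.
\<close>
lemma powr_midpoint_strong:
  fixes a b p R :: real
  assumes "1 < p" "p \<le> 2" "0 < R" "\<bar>a\<bar> \<le> R" "\<bar>b\<bar> \<le> R"
  shows "\<bar>(a + b) / 2\<bar> powr p + p * (p - 1) / 8 * R powr (p - 2) * (a - b)\<^sup>2
      \<le> (\<bar>a\<bar> powr p + \<bar>b\<bar> powr p) / 2"
proof -
  define \<kappa> where "\<kappa> = p * (p - 1) / 2 * R powr (p - 2)"
  define D where "D = (\<lambda>t::real. p * sgn t * \<bar>t\<bar> powr (p - 1) - 2 * \<kappa> * t)"
  have D_nonneg: "0 \<le> D t" if "0 \<le> t" "t \<le> R" for t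
  proof (cases "t = 0")
    case False
    then have t: "t > 0" using that by simp
    have "R powr (p - 2) \<le> t powr (p - 2)"
      using assms that t by (intro powr_mono2') auto
    then have "(p - 1) * R powr (p - 2) \<le> 1 * t powr (p - 2)"
      using assms by (intro mult_mono) auto
    then have "0 \<le> p * t * (t powr (p - 2) - (p - 1) * R powr (p - 2))"
      using assms t by simp
    also have "\<dots> = p * (t powr (p - 2) * t powr 1) - t * (2 * \<kappa>)"
      using t by (simp add: \<kappa>_def field_simps)
    also have "t powr (p - 2) * t powr 1 = t powr (p - 1)" unfolding powr_add[symmetric] by simp
    also have "p * t powr (p - 1) - t * (2 * \<kappa>) = D t" using t by (simp add: D_def)
    finally show ?thesis .
  qed (simp add: D_def)
  have D_mono_pos: "D s \<le> D t" if "0 \<le> s" "s \<le> t" "t \<le> R" for s t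
  proof (cases "s = 0")
    case True
    then show ?thesis using D_nonneg[of t] that by (simp add: D_def)
  next
    case False
    have "p * s powr (p - 1) - 2 * \<kappa> * s \<le> p * t powr (p - 1) - 2 * \<kappa> * t"
    proof (rule DERIV_nonneg_imp_nondecreasing[OF \<open>s \<le> t\<close>])
      fix u assume u: "s \<le> u" "u \<le> t"
      have "((\<lambda>u. p * u powr (p - 1) - 2 * \<kappa> * u) has_real_derivative
          p * ((p - 1) * u powr (p - 2)) - 2 * \<kappa>) (at u)"
        using u False that by (auto intro!: derivative_eq_intros)
      moreover have "0 \<le> p * ((p - 1) * u powr (p - 2)) - 2 * \<kappa>"
      proof -
        have "R powr (p - 2) \<le> u powr (p - 2)"
          using assms that u False by (intro powr_mono2') auto
        then have "0 \<le> p * (p - 1) * (u powr (p - 2) - R powr (p - 2))"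
          using assms by simp
        then show ?thesis by (simp add: \<kappa>_def field_simps)
      qed
      ultimately show "\<exists>y. ((\<lambda>u. p * u powr (p - 1) - 2 * \<kappa> * u) has_real_derivative y) (at u)
          \<and> 0 \<le> y" by blast
    qed
    then show ?thesis using that False by (simp add: D_def)
  qed
  have D_odd: "D (- t) = - D t" for t by (simp add: D_def)
  have D_mono: "D s \<le> D t" if "- R \<le> s" "s \<le> t" "t \<le> R" for s t
  proof (cases "0 \<le> s")
    case True
    then show ?thesis using D_mono_pos that by blast
  next
    case neg: False
    show ?thesis
    proof (cases "0 \<le> t")
      case True
      then have "0 \<le> D t" "0 \<le> D (- s)" using neg that by (auto intro!: D_nonneg)
      then show ?thesis by (simp add: D_odd)
    next
      case False
      then have "D (- t) \<le> D (- s)" using that by (intro D_mono_pos) auto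
      then show ?thesis by (simp add: D_odd)
    qed
  qed
  have "convex_on {- R..R} (\<lambda>t. \<bar>t\<bar> powr p - \<kappa> * t\<^sup>2)"
  proof (rule convex_on_realI[where f' = D])
    show "((\<lambda>t. \<bar>t\<bar> powr p - \<kappa> * t\<^sup>2) has_real_derivative D t) (at t)" for t
      unfolding D_def
      by (rule derivative_eq_intros has_real_derivative_abs_powr[OF assms(1)] refl)+ simp
    show "D s \<le> D t" if "s \<in> {- R..R}" "t \<in> {- R..R}" "s \<le> t" for s t
      using that D_mono by auto
  qed auto
  then have "\<bar>(1 - 1/2) *\<^sub>R a + (1/2) *\<^sub>R b\<bar> powr p - \<kappa> * ((1 - 1/2) *\<^sub>R a + (1/2) *\<^sub>R b)\<^sup>2
      \<le> (1 - 1/2) * (\<bar>a\<bar> powr p - \<kappa> * a\<^sup>2) + (1/2) * (\<bar>b\<bar> powr p - \<kappa> * b\<^sup>2)"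
    by (rule convex_onD) (use assms in \<open>auto simp: abs_le_iff\<close>)
  moreover have "(1 - 1/2) *\<^sub>R a + (1/2) *\<^sub>R b = (a + b) / 2" by (simp add: field_simps)
  ultimately have "\<bar>(a + b) / 2\<bar> powr p - \<kappa> * ((a + b) / 2)\<^sup>2
      \<le> (1 - 1/2) * (\<bar>a\<bar> powr p - \<kappa> * a\<^sup>2) + (1/2) * (\<bar>b\<bar> powr p - \<kappa> * b\<^sup>2)"
    by (simp only:)
  moreover have "\<kappa> * a\<^sup>2 / 2 + \<kappa> * b\<^sup>2 / 2 - \<kappa> * ((a + b) / 2)\<^sup>2
      = p * (p - 1) / 8 * R powr (p - 2) * (a - b)\<^sup>2"
    by (simp add: \<kappa>_def power2_eq_square field_simps)
  ultimately show ?thesis by argo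
qed

section \<open>Interpolation\<close>

text \<open>
  Interpolation between the exponents \<open>i\<close> and \<open>p\<close> with a free threshold \<open>s\<close>: the first summand
  dominates for \<open>t \<le> s\<close>, the second for \<open>t > s\<close>.  Summed over coordinates, \<open>i = 1\<close> involves the
  \<open>l1\<close> norm and \<open>i = 0\<close> the number of nonzero coordinates.
\<close>
lemma square_le_power_plus_powr:
  fixes p s t :: real
  assumes "2 \<le> p" "0 < s" "0 \<le> t" "i \<le> 2"
  shows "t\<^sup>2 \<le> s ^ (2 - i) * t ^ i + s powr (2 - p) * t powr p"
proof (cases "t \<le> s")
  case True
  have "t\<^sup>2 = t ^ (2 - i) * t ^ i" using assms by (simp flip: power_add)
  also have "\<dots> \<le> s ^ (2 - i) * t ^ i"
    using True assms by (intro mult_right_mono power_mono) auto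
  finally show ?thesis by (simp add: add_increasing2)
next
  case False
  then have t: "t > 0" using assms by simp
  have "t\<^sup>2 = t powr (2 - p) * t powr p"
    using t by (simp flip: powr_add)
  also have "\<dots> \<le> s powr (2 - p) * t powr p"
    using False assms by (intro mult_right_mono powr_mono2') auto
  finally show ?thesis using assms by (simp add: add_increasing)
qed

text \<open>
  Optimizing the threshold \<open>s\<close> in the summed interpolation inequality bounds the \<open>lp\<close> quantity \<open>P\<close>
  from below by a power of the Euclidean norm \<open>X\<close>.
\<close>
lemma powr_le_of_interpolation:
  fixes p a B P X :: real
  assumes "2 \<le> p" "0 < a" "0 < B" "0 \<le> X"
    and bound: "\<And>s. 0 < s \<Longrightarrow> X\<^sup>2 \<le> B * s powr a + s powr (2 - p) * P"
    and "0 \<le> P"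
  shows "1 / 2 * (1 / (2 * B)) powr ((p - 2) / a) * X powr (2 + 2 * (p - 2) / a) \<le> P"
proof (cases "X = 0")
  case False
  then have X: "X > 0" using assms by simp
  \<comment> \<open>This threshold makes the first summand of the bound equal to half of the left-hand side.\<close>
  define s where "s = (X\<^sup>2 / (2 * B)) powr (1 / a)"
  have s: "s > 0" using X assms by (simp add: s_def)
  have "B * s powr a = X\<^sup>2 / 2"
    using assms X by (simp add: s_def powr_powr)
  then have "X powr 2 / 2 \<le> s powr (2 - p) * P" using bound[OF s] X by simp
  then have "s powr (p - 2) * (X powr 2 / 2) \<le> s powr (p - 2) * (s powr (2 - p) * P)"
    by (intro mult_left_mono) auto
  also have "\<dots> = P" using s by (simp add: mult.assoc[symmetric] flip: powr_add)
  also have "s powr (p - 2) = (1 / (2 * B)) powr ((p - 2) / a) * (X powr 2) powr ((p - 2) / a)"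
    using assms X by (simp add: s_def powr_powr powr_mult powr_divide)
  finally show ?thesis
    using X by (simp add: powr_powr powr_add mult_ac del: powr_numeral)
qed (use assms in auto)

section \<open>Rates of recursively bounded sequences\<close>

lemma powr_neg_diff_le:
  fixes \<alpha> :: real and n :: nat
  assumes "0 < \<alpha>" "1 \<le> n"
  shows "real n powr (- \<alpha>) - real (Suc n) powr (- \<alpha>) \<le> \<alpha> * real n powr (- \<alpha> - 1)"
proof -
  have "\<exists>z>real n. z < real (Suc n) \<and>
      real (Suc n) powr (- \<alpha>) - real n powr (- \<alpha>)
        = (real (Suc n) - real n) * (- \<alpha> * z powr (- \<alpha> - 1))"
    by (rule MVT2) (use assms in \<open>auto intro!: derivative_eq_intros\<close>)
  then obtain z where z: "z > real n"
    "real (Suc n) powr (- \<alpha>) - real n powr (- \<alpha>) = - \<alpha> * z powr (- \<alpha> - 1)" by auto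
  have "z powr (- \<alpha> - 1) \<le> real n powr (- \<alpha> - 1)"
    using z assms by (intro powr_mono2') auto
  then have "\<alpha> * z powr (- \<alpha> - 1) \<le> \<alpha> * real n powr (- \<alpha> - 1)"
    using assms by (intro mult_left_mono) auto
  then show ?thesis using z by linarith
qed

text \<open>
  A discrete analogue of the differential inequality \<open>r' \<le> - r powr (1 + \<theta>) / K\<close>.  If the bound
  \<open>C * n powr - (1 / \<theta>)\<close> held at \<open>n\<close> and failed at \<open>n + 1\<close>, the decrease \<open>r n - r (n + 1)\<close> would be
  smaller than the one that the recursion forces, once \<open>C\<close> is large enough.
\<close>
lemma polynomial_rate:
  fixes r :: "nat \<Rightarrow> real" and \<theta> K :: real
  assumes \<theta>: "0 < \<theta>" and K: "0 < K" and nonneg: "\<And>n. 1 \<le> n \<Longrightarrow> 0 \<le> r n"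
    and decr: "\<And>n. 1 \<le> n \<Longrightarrow> r (Suc n) \<le> r n"
    and rec: "\<And>n. n0 \<le> n \<Longrightarrow> r (Suc n) powr (1 + \<theta>) \<le> K * (r n - r (Suc n))"
    and "1 \<le> n0"
  obtains C where "0 < C" "\<And>n. 1 \<le> n \<Longrightarrow> r n \<le> C * real n powr (- (1 / \<theta>))"
proof -
  define \<alpha> where "\<alpha> = 1 / \<theta>"
  have \<alpha>: "\<alpha> > 0" using \<theta> by (simp add: \<alpha>_def)
  \<comment> \<open>The first summand makes the induction step work, the second one covers the indices up to \<open>n0\<close>.\<close>
  define C where "C = (K * \<alpha> * 2 powr (\<alpha> + 1)) powr \<alpha> + r 1 * real n0 powr \<alpha>"
  have first: "(K * \<alpha> * 2 powr (\<alpha> + 1)) powr \<alpha> \<le> C"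
    using nonneg[of 1] by (simp add: C_def)
  moreover have "0 < (K * \<alpha> * 2 powr (\<alpha> + 1)) powr \<alpha>" using K \<alpha> by simp
  ultimately have C: "0 < C" by linarith
  have "((K * \<alpha> * 2 powr (\<alpha> + 1)) powr \<alpha>) powr \<theta> \<le> C powr \<theta>"
    using first \<theta> by (intro powr_mono2) auto
  then have C_large: "K * \<alpha> * 2 powr (\<alpha> + 1) \<le> C powr \<theta>"
    using \<theta> K \<alpha> by (simp add: powr_powr \<alpha>_def)
  have start: "r n \<le> C * real n powr (- \<alpha>)" if "1 \<le> n" "n \<le> n0" for n
  proof -
    have "r n \<le> r 1"
      using that(1) by (induction n rule: dec_induct) (auto dest: decr[simplified] intro: order_trans)
    also have "r 1 * 1 \<le> r 1 * (real n0 powr \<alpha> * real n powr (- \<alpha>))"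
    proof (rule mult_left_mono)
      have "real n powr \<alpha> \<le> real n0 powr \<alpha>" using that \<alpha> by (intro powr_mono2) auto
      then show "1 \<le> real n0 powr \<alpha> * real n powr (- \<alpha>)"
        using that by (simp add: powr_minus divide_simps)
    qed (use nonneg in auto)
    also have "\<dots> \<le> C * real n powr (- \<alpha>)"
      by (simp add: C_def algebra_simps)
    finally show ?thesis by simp
  qed
  have tail: "r n \<le> C * real n powr (- \<alpha>)" if "n0 \<le> n" for n
    using that
  proof (induction n rule: dec_induct)
    case base
    then show ?case using start[of n0] \<open>1 \<le> n0\<close> by simp
  next
    case (step n)
    have n: "1 \<le> n" using step \<open>1 \<le> n0\<close> by simp
    show ?case
    proof (rule ccontr)
      assume "\<not> r (Suc n) \<le> C * real (Suc n) powr (- \<alpha>)"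
      then have big: "C * real (Suc n) powr (- \<alpha>) < r (Suc n)" by simp
      have "C * C powr \<theta> * real (Suc n) powr (- \<alpha> - 1) = (C * real (Suc n) powr (- \<alpha>)) powr (1 + \<theta>)"
      proof -
        have "- \<alpha> * (1 + \<theta>) = - \<alpha> - 1" using \<theta> by (simp add: \<alpha>_def field_simps)
        then have "(C * real (Suc n) powr (- \<alpha>)) powr (1 + \<theta>)
            = C powr (1 + \<theta>) * real (Suc n) powr (- \<alpha> - 1)"
          using C by (simp only: powr_mult powr_powr)
        then show ?thesis using C by (simp add: powr_add)
      qed
      also have "\<dots> \<le> r (Suc n) powr (1 + \<theta>)"
        using big C \<theta> by (intro powr_mono2) auto
      also have "\<dots> \<le> K * (r n - r (Suc n))" using rec step by simp
      also have "\<dots> < K * (C * real n powr (- \<alpha>) - C * real (Suc n) powr (- \<alpha>))"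
        using K step.IH big by (intro mult_strict_left_mono) auto
      also have "\<dots> = K * C * (real n powr (- \<alpha>) - real (Suc n) powr (- \<alpha>))"
        by (simp add: algebra_simps)
      also have "\<dots> \<le> K * C * (\<alpha> * real n powr (- \<alpha> - 1))"
        using K C n \<alpha> by (intro mult_left_mono powr_neg_diff_le) auto
      finally have lt: "C powr \<theta> * real (Suc n) powr (- \<alpha> - 1) < K * \<alpha> * real n powr (- \<alpha> - 1)"
        using C by (simp add: mult_ac)
      have "real n powr (- \<alpha> - 1) \<le> (real (Suc n) / 2) powr (- \<alpha> - 1)"
        using n \<alpha> by (intro powr_mono2') auto
      also have "\<dots> = 2 powr (\<alpha> + 1) * real (Suc n) powr (- \<alpha> - 1)"
      proof -
        have "(2::real) powr (\<alpha> + 1) * 2 powr (- \<alpha> - 1) = 1" by (simp flip: powr_add)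
        then have "2 powr (\<alpha> + 1) = 1 / (2::real) powr (- \<alpha> - 1)" by (simp add: field_simps)
        then show ?thesis by (subst powr_divide) auto
      qed
      finally have "K * \<alpha> * real n powr (- \<alpha> - 1)
          \<le> K * \<alpha> * (2 powr (\<alpha> + 1) * real (Suc n) powr (- \<alpha> - 1))"
        using K \<alpha> by (intro mult_left_mono) auto
      also have "\<dots> \<le> C powr \<theta> * real (Suc n) powr (- \<alpha> - 1)"
        using C_large by (simp add: mult.assoc[symmetric] mult_right_mono)
      finally show False using lt by simp
    qed
  qed
  show ?thesis
    using that[OF C] start tail unfolding \<alpha>_def by (meson nat_le_linear)
qed

section \<open>Uniform midpoint convexity on sublevel sets\<close>

text \<open>
  The constant may depend on the level \<open>M\<close>: the penalties considered below are in general uniformly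
  convex on sublevel sets only.  The set \<open>S\<close> is contained in the domain on which an extended-real-valued
  function is finite, so the midpoint of two points of \<open>S\<close> has to be shown to lie in \<open>S\<close>.
\<close>
definition uniformly_midconvex :: "'a::real_normed_vector set \<Rightarrow> ('a \<Rightarrow> real) \<Rightarrow> real \<Rightarrow> bool" where
  "uniformly_midconvex S F q \<longleftrightarrow> (\<forall>M. \<exists>c>0. \<forall>x\<in>S. \<forall>u\<in>S. F x \<le> M \<longrightarrow> F u \<le> M \<longrightarrow>
     (1/2) *\<^sub>R (x + u) \<in> S \<and>
     F ((1/2) *\<^sub>R (x + u)) + c * norm (x - u) powr q \<le> (F x + F u) / 2)"

lemma uniformly_midconvexE:
  assumes "uniformly_midconvex S F q"
  obtains c where "0 < c"
    "\<And>x u. x \<in> S \<Longrightarrow> u \<in> S \<Longrightarrow> F x \<le> M \<Longrightarrow> F u \<le> M \<Longrightarrow> (1/2) *\<^sub>R (x + u) \<in> S"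
    "\<And>x u. x \<in> S \<Longrightarrow> u \<in> S \<Longrightarrow> F x \<le> M \<Longrightarrow> F u \<le> M \<Longrightarrow>
       F ((1/2) *\<^sub>R (x + u)) + c * norm (x - u) powr q \<le> (F x + F u) / 2"
  using assms unfolding uniformly_midconvex_def by metis

text \<open>
  The midpoint of two almost minimizing points has value at least the infimum, so the points are
  close to each other.  Minimizing sequences are therefore Cauchy, and the closed sublevel sets contain the
  limit.
\<close>
lemma uniformly_midconvex_minimizer_exists:
  fixes F :: "'a::{real_normed_vector, complete_space} \<Rightarrow> real"
  assumes ne: "S \<noteq> {}" and bdd: "\<And>z. z \<in> S \<Longrightarrow> b \<le> F z"
    and conv: "uniformly_midconvex S F q" and q: "0 < q"
    and closed: "\<And>M. closed {z \<in> S. F z \<le> M}"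
  shows "\<exists>z\<in>S. \<forall>u\<in>S. F z \<le> F u"
proof -
  define m where "m = Inf (F ` S)"
  have bb: "bdd_below (F ` S)" using bdd by (auto simp: bdd_below_def)
  have m_le: "m \<le> F u" if "u \<in> S" for u
    unfolding m_def using that bb by (simp add: cInf_lower)
  have "\<exists>z\<in>S. F z < m + inverse (real (Suc n))" for n
    using cInf_lessD[of "F ` S" "m + inverse (real (Suc n))"] ne by (force simp: m_def)
  then obtain s where s: "\<And>n. s n \<in> S" "\<And>n. F (s n) < m + inverse (real (Suc n))" by metis
  have s_le: "F (s n) \<le> m + inverse (real (Suc k))" if "k \<le> n" for n k
  proof -
    have "inverse (real (Suc n)) \<le> inverse (real (Suc k))" using that by (simp add: field_simps)
    then show ?thesis using s(2)[of n] by linarith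
  qed
  have s_le1: "F (s n) \<le> m + 1" for n using s_le[of 0 n] by simp
  obtain c where c: "0 < c"
    "\<And>x u. x \<in> S \<Longrightarrow> u \<in> S \<Longrightarrow> F x \<le> m + 1 \<Longrightarrow> F u \<le> m + 1 \<Longrightarrow> (1/2) *\<^sub>R (x + u) \<in> S"
    "\<And>x u. x \<in> S \<Longrightarrow> u \<in> S \<Longrightarrow> F x \<le> m + 1 \<Longrightarrow> F u \<le> m + 1 \<Longrightarrow>
       F ((1/2) *\<^sub>R (x + u)) + c * norm (x - u) powr q \<le> (F x + F u) / 2"
    using uniformly_midconvexE[OF conv, of "m + 1"] by blast
  have "Cauchy s"
  proof (rule metric_CauchyI)
    fix \<epsilon> :: real assume \<epsilon>: "0 < \<epsilon>"
    obtain n0 where n0: "inverse (real (Suc n0)) < c * \<epsilon> powr q"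
      using reals_Archimedean[of "c * \<epsilon> powr q"] c(1) \<epsilon> by auto
    have "dist (s i) (s j) < \<epsilon>" if "n0 \<le> i" "n0 \<le> j" for i j
    proof -
      have "m + c * norm (s i - s j) powr q \<le> (F (s i) + F (s j)) / 2"
        using c(3)[of "s i" "s j"] m_le[OF c(2)[of "s i" "s j"]] s(1) s_le1 by force
      also have "\<dots> \<le> m + inverse (real (Suc n0))" using s_le[OF that(1)] s_le[OF that(2)] by simp
      finally have "c * norm (s i - s j) powr q < c * \<epsilon> powr q" using n0 by simp
      then have "norm (s i - s j) powr q < \<epsilon> powr q" using c(1) by simp
      then show ?thesis
        using \<epsilon> q powr_mono2[of q \<epsilon> "norm (s i - s j)"] by (force simp: dist_norm)
    qed
    then show "\<exists>M. \<forall>i\<ge>M. \<forall>j\<ge>M. dist (s i) (s j) < \<epsilon>" by blast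
  qed
  then obtain z where z: "s \<longlonglongrightarrow> z" using Cauchy_convergent convergent_def by blast
  have z_le: "z \<in> S \<and> F z \<le> m + inverse (real (Suc k))" for k
  proof -
    have "eventually (\<lambda>n. s n \<in> {z \<in> S. F z \<le> m + inverse (real (Suc k))}) sequentially"
      using eventually_ge_at_top[of k] by eventually_elim (use s(1) s_le in auto)
    then show ?thesis using Lim_in_closed_set[OF closed _ _ z] by fastforce
  qed
  have "(\<lambda>k. m + inverse (real (Suc k))) \<longlonglongrightarrow> m + 0"
    by (intro tendsto_add tendsto_const LIMSEQ_inverse_real_of_nat)
  then have "F z \<le> m" using z_le LIMSEQ_le_const[of _ "m + 0" "F z"] by auto
  then show ?thesis using z_le m_le by (meson order_trans)
qed

text \<open>
  Compare \<open>F z\<close> with the value at the midpoint of \<open>z\<close> and \<open>u\<close>.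
\<close>
lemma uniformly_midconvex_growth:
  fixes F :: "'a::real_normed_vector \<Rightarrow> real"
  assumes conv: "uniformly_midconvex S F q" and z: "z \<in> S" "\<And>u. u \<in> S \<Longrightarrow> F z \<le> F u"
  obtains c where "0 < c" "\<And>u. u \<in> S \<Longrightarrow> F u \<le> M \<Longrightarrow> c * norm (u - z) powr q \<le> F u - F z"
proof -
  obtain c where c: "0 < c"
    "\<And>x u. x \<in> S \<Longrightarrow> u \<in> S \<Longrightarrow> F x \<le> M \<Longrightarrow> F u \<le> M \<Longrightarrow> (1/2) *\<^sub>R (x + u) \<in> S"
    "\<And>x u. x \<in> S \<Longrightarrow> u \<in> S \<Longrightarrow> F x \<le> M \<Longrightarrow> F u \<le> M \<Longrightarrow>
       F ((1/2) *\<^sub>R (x + u)) + c * norm (x - u) powr q \<le> (F x + F u) / 2"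
    using uniformly_midconvexE[OF conv, of M] by blast
  show ?thesis
  proof (rule that[of "2 * c"])
    fix u assume u: "u \<in> S" "F u \<le> M"
    then have zM: "F z \<le> M" using z(2) by force
    have "F z \<le> F ((1/2) *\<^sub>R (u + z))" using z c(2)[OF u(1) z(1) u(2) zM] by blast
    then show "2 * c * norm (u - z) powr q \<le> F u - F z"
      using c(3)[OF u(1) z(1) u(2) zM] by simp
  qed (use c in simp)
qed

lemma uniformly_midconvex_minimizer_unique:
  fixes F :: "'a::real_normed_vector \<Rightarrow> real"
  assumes "uniformly_midconvex S F q"
    and "z \<in> S" "\<And>u. u \<in> S \<Longrightarrow> F z \<le> F u" and "z' \<in> S" "\<And>u. u \<in> S \<Longrightarrow> F z' \<le> F u"
  shows "z' = z"
proof -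
  obtain c where "0 < c" "c * norm (z' - z) powr q \<le> F z' - F z"
    using uniformly_midconvex_growth[OF assms(1-3), of "F z'"] assms(4) by blast
  then have "c * norm (z' - z) powr q \<le> 0" using assms by (meson diff_le_0_iff_le order_trans)
  with \<open>0 < c\<close> show ?thesis by (simp add: mult_le_0_iff)
qed

lemma uniformly_midconvex_add:
  assumes "uniformly_midconvex S G q" and "\<And>z. 0 \<le> H z"
    and "\<And>x u. H ((1/2) *\<^sub>R (x + u)) \<le> (H x + H u) / 2"
  shows "uniformly_midconvex S (\<lambda>z. G z + H z) q"
  unfolding uniformly_midconvex_def
proof
  fix M
  obtain c where c: "0 < c"
    "\<And>x u. x \<in> S \<Longrightarrow> u \<in> S \<Longrightarrow> G x \<le> M \<Longrightarrow> G u \<le> M \<Longrightarrow> (1/2) *\<^sub>R (x + u) \<in> S"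
    "\<And>x u. x \<in> S \<Longrightarrow> u \<in> S \<Longrightarrow> G x \<le> M \<Longrightarrow> G u \<le> M \<Longrightarrow>
       G ((1/2) *\<^sub>R (x + u)) + c * norm (x - u) powr q \<le> (G x + G u) / 2"
    using uniformly_midconvexE[OF assms(1), of M] by blast
  have "G x \<le> M" if "G x + H x \<le> M" for x using that assms(2)[of x] by linarith
  moreover have "G ((1/2) *\<^sub>R (x + u)) + H ((1/2) *\<^sub>R (x + u)) + c * norm (x - u) powr q
      \<le> ((G x + H x) + (G u + H u)) / 2"
    if "x \<in> S" "u \<in> S" "G x \<le> M" "G u \<le> M" for x u
    using c(3)[OF that] assms(3)[of x u] by argo
  ultimately show "\<exists>c>0. \<forall>x\<in>S. \<forall>u\<in>S. G x + H x \<le> M \<longrightarrow> G u + H u \<le> M \<longrightarrow>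
     (1/2) *\<^sub>R (x + u) \<in> S \<and>
     G ((1/2) *\<^sub>R (x + u)) + H ((1/2) *\<^sub>R (x + u)) + c * norm (x - u) powr q
       \<le> (G x + H x + (G u + H u)) / 2"
    using c(1,2) by blast
qed

text \<open>
  Lower semicontinuity of \<open>G\<close> (infinite outside \<open>S\<close>) is expressed by closed sublevel sets; it is stable
  under adding a continuous function.
\<close>
lemma closed_sublevel_add:
  fixes G H :: "'a::metric_space \<Rightarrow> real"
  assumes G: "\<And>M. closed {z \<in> S. G z \<le> M}" and H: "continuous_on UNIV H"
  shows "closed {z \<in> S. G z + H z \<le> M}"
  unfolding closed_sequential_limits
proof (intro allI impI, elim conjE)
  fix s z assume s: "\<forall>n. s n \<in> {z \<in> S. G z + H z \<le> M}" and z: "s \<longlonglongrightarrow> z"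
  have lim: "(\<lambda>n. H (s n)) \<longlonglongrightarrow> H z"
    using continuous_on_tendsto_compose[OF H z] by simp
  have *: "z \<in> S \<and> G z \<le> M - H z + \<epsilon>" if "0 < \<epsilon>" for \<epsilon>
  proof -
    have "eventually (\<lambda>n. H z - \<epsilon> < H (s n)) sequentially"
      using order_tendstoD(1)[OF lim, of "H z - \<epsilon>"] that by simp
    then have "eventually (\<lambda>n. s n \<in> {u \<in> S. G u \<le> M - H z + \<epsilon>}) sequentially"
    proof (rule eventually_mono)
      fix n assume "H z - \<epsilon> < H (s n)"
      then show "s n \<in> {u \<in> S. G u \<le> M - H z + \<epsilon>}" using s[rule_format, of n] by simp
    qed
    then show ?thesis using Lim_in_closed_set[OF G _ _ z] by fastforce
  qed
  then have "z \<in> S" using zero_less_one by blast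
  moreover have "G z \<le> M - H z" by (rule field_le_epsilon) (use * in blast)
  ultimately show "z \<in> {z \<in> S. G z + H z \<le> M}" by simp
qed

section \<open>The Riesz representation and the gradient of a least-squares functional\<close>

lemma norm_midpoint_sq:
  fixes x u :: "'a::real_inner"
  shows "(norm ((1/2) *\<^sub>R (x + u)))\<^sup>2 = ((norm x)\<^sup>2 + (norm u)\<^sup>2) / 2 - (norm (x - u))\<^sup>2 / 4"
  by (simp add: power2_norm_eq_inner inner_add_left inner_add_right inner_diff_left
      inner_diff_right inner_commute field_simps)

lemma norm_midpoint_diff_sq_le:
  fixes x u v :: "'a::real_inner"
  shows "(norm ((1/2) *\<^sub>R (x + u) - v))\<^sup>2 \<le> ((norm (x - v))\<^sup>2 + (norm (u - v))\<^sup>2) / 2"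
proof -
  have eq: "(1/2) *\<^sub>R (x + u) - v = (1/2) *\<^sub>R ((x - v) + (u - v))"
    by (simp add: algebra_simps flip: scaleR_add_left)
  show ?thesis unfolding eq norm_midpoint_sq
    using zero_le_power2[of "norm (x - v - (u - v))"] by linarith
qed

text \<open>
  The functional \<open>1/2 * (norm z)\<^sup>2 - l z\<close> is uniformly midpoint convex by the parallelogram law, and the
  vanishing of its first variation at the minimizer \<open>D\<close> says that \<open>D\<close> represents \<open>l\<close>.
\<close>
lemma riesz_representation:
  fixes l :: "'a::{real_inner, complete_space} \<Rightarrow> real"
  assumes "bounded_linear l"
  obtains D where "\<And>v. D \<bullet> v = l v"
proof -
  interpret l: bounded_linear l by fact
  obtain B where B: "\<And>v. \<bar>l v\<bar> \<le> norm v * B" using l.bounded by auto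
  define F where "F = (\<lambda>z. 1/2 * (norm z)\<^sup>2 - l z)"
  have "\<exists>D\<in>UNIV. \<forall>u\<in>UNIV. F D \<le> F u"
  proof (rule uniformly_midconvex_minimizer_exists[where q = 2])
    show "- B\<^sup>2 / 2 \<le> F z" for z
    proof -
      have "0 \<le> (norm z - B)\<^sup>2" by simp
      then show ?thesis using B[of z] by (simp add: F_def power2_eq_square algebra_simps)
    qed
    have "F ((1/2) *\<^sub>R (x + u)) + 1/8 * norm (x - u) powr 2 \<le> (F x + F u) / 2" for x u
      unfolding F_def norm_midpoint_sq by (simp add: l.scaleR l.add field_simps)
    then show "uniformly_midconvex UNIV F 2"
      unfolding uniformly_midconvex_def by (intro allI exI[of _ "1/8"]) auto
    have "continuous_on UNIV F" unfolding F_def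
      by (intro continuous_intros linear_continuous_on assms)
    then show "closed {z \<in> UNIV. F z \<le> M}" for M
      by (simp add: closed_Collect_le)
  qed auto
  then obtain D where D: "\<And>u. F D \<le> F u" by auto
  have "D \<bullet> v = l v" for v
  proof (cases "v = 0")
    case False
    define w where "w = D \<bullet> v - l v"
    define t where "t = - w / (norm v)\<^sup>2"
    have "(norm (D + t *\<^sub>R v))\<^sup>2 = (norm D)\<^sup>2 + 2 * t * (D \<bullet> v) + t\<^sup>2 * (norm v)\<^sup>2"
      unfolding power2_norm_eq_inner
      by (simp add: inner_add_left inner_add_right inner_commute power2_eq_square algebra_simps)
    then have "F (D + t *\<^sub>R v) - F D = t * w + t\<^sup>2 / 2 * (norm v)\<^sup>2"
      by (simp add: F_def w_def l.add l.scaleR field_simps)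
    also have "\<dots> = - (w\<^sup>2 / (norm v)\<^sup>2) / 2"
      using False by (simp add: t_def power2_eq_square field_simps)
    finally have "w\<^sup>2 / (norm v)\<^sup>2 \<le> 0" using D[of "D + t *\<^sub>R v"] by simp
    then have "w = 0" using False by (simp add: divide_le_0_iff)
    then show ?thesis by (simp add: w_def)
  qed (simp add: l.zero)
  then show ?thesis using that by blast
qed

text \<open>
  The gradient is the adjoint of \<open>A\<close> applied to \<open>A x - y\<close>.  Its existence is the Riesz representation of
  \<open>\<lambda>v. (A x - y) \<bullet> A v\<close>, and testing against \<open>v\<close> avoids naming the adjoint.
\<close>
lemma inner_gradient_least_squares:
  fixes A :: "'a::{real_inner, complete_space} \<Rightarrow> 'b::real_inner"
  assumes A: "bounded_linear A"
  shows "gradient (\<lambda>z. 1 / 2 * (norm (A z - y))\<^sup>2) x \<bullet> v = (A x - y) \<bullet> A v"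
proof -
  have "bounded_linear (\<lambda>v. (A x - y) \<bullet> A v)"
    using bounded_linear_compose[OF bounded_linear_inner_right A] .
  then obtain D where D: "\<And>v. D \<bullet> v = (A x - y) \<bullet> A v" by (rule riesz_representation) blast
  have "((\<lambda>z. 1 / 2 * ((A z - y) \<bullet> (A z - y))) has_derivative (\<lambda>v. v \<bullet> D)) (at x)"
    by (rule derivative_eq_intros bounded_linear_imp_has_derivative[OF A] refl)+
      (use D in \<open>simp add: inner_commute fun_eq_iff\<close>)
  then have G: "GDERIV (\<lambda>z. 1 / 2 * (norm (A z - y))\<^sup>2) x :> D"
    by (simp add: gderiv_def power2_norm_eq_inner)
  have "gradient (\<lambda>z. 1 / 2 * (norm (A z - y))\<^sup>2) x = D"
    unfolding gradient_def
  proof (rule the_equality)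
    show "GDERIV (\<lambda>z. 1 / 2 * (norm (A z - y))\<^sup>2) x :> D" by (rule G)
  next
    fix D' assume "GDERIV (\<lambda>z. 1 / 2 * (norm (A z - y))\<^sup>2) x :> D'"
    then have "(\<lambda>v. v \<bullet> D') = (\<lambda>v. v \<bullet> D)"
      using G unfolding gderiv_def by (rule has_derivative_unique)
    then show "D' = D" by (metis vector_eq_ldot)
  qed
  then show ?thesis using D by simp
qed

section \<open>Coordinates with respect to an orthonormal basis\<close>

locale hilbert_basis =
  fixes N :: "nat set" and e :: "nat \<Rightarrow> 'a::real_inner"
  assumes basis: "orthonormal_basis N e"
begin

lemma norm_basis: "k \<in> N \<Longrightarrow> norm (e k) = 1"
  and inner_basis: "j \<in> N \<Longrightarrow> k \<in> N \<Longrightarrow> e j \<bullet> e k = (if j = k then 1 else 0)"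
  using basis by (auto simp: orthonormal_basis_def pairwise_def norm_eq_1)

lemma finite_span_approx:
  assumes "0 < \<epsilon>"
  obtains F v where "finite F" "F \<subseteq> N" "v \<in> span (e ` F)" "norm (x - v) < \<epsilon>"
proof -
  have "x \<in> closure (span (e ` N))" using basis by (simp add: orthonormal_basis_def)
  then obtain v where v: "v \<in> span (e ` N)" "norm (x - v) < \<epsilon>"
    using assms by (force simp: closure_approachable dist_norm norm_minus_commute)
  obtain t r where t: "finite t" "t \<subseteq> e ` N" "v = (\<Sum>a\<in>t. r a *\<^sub>R a)"
    using v(1) by (auto simp: span_explicit)
  then obtain F where F: "finite F" "F \<subseteq> N" "t = e ` F" by (meson finite_subset_image)
  have "v \<in> span (e ` F)" unfolding t(3) F(3) by (intro span_sum span_scale span_base)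
  then show ?thesis using that F v by blast
qed

text \<open>
  A vector in the span of finitely many basis vectors that is \<open>\<epsilon>\<close>-close to \<open>x\<close> has no coordinates
  elsewhere, so all other coordinates of \<open>x\<close> are smaller than \<open>\<epsilon>\<close>.
\<close>
lemma finite_large_coordinates:
  assumes "0 < \<epsilon>"
  shows "finite {k \<in> N. \<epsilon> \<le> \<bar>x \<bullet> e k\<bar>}"
proof -
  obtain F v where F: "finite F" "F \<subseteq> N" "v \<in> span (e ` F)" "norm (x - v) < \<epsilon>"
    using finite_span_approx[OF assms] by blast
  have "\<bar>x \<bullet> e k\<bar> < \<epsilon>" if "k \<in> N" "k \<notin> F" for k
  proof -
    have "orthogonal (e k) v"
      using F that by (intro orthogonal_to_span[OF F(3)]) (auto simp: orthogonal_def inner_basis)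
    then have "\<bar>x \<bullet> e k\<bar> = \<bar>(x - v) \<bullet> e k\<bar>"
      by (simp add: inner_diff_left orthogonal_def inner_commute[of v])
    also have "\<dots> \<le> norm (x - v)"
      using Cauchy_Schwarz_ineq2[of "x - v" "e k"] that by (simp add: norm_basis)
    finally show ?thesis using F by simp
  qed
  then have "{k \<in> N. \<epsilon> \<le> \<bar>x \<bullet> e k\<bar>} \<subseteq> F" by force
  then show ?thesis using F(1) finite_subset by blast
qed

text \<open>
  The nontrivial half of Parseval's identity: the projection \<open>P\<close> onto a finite set of coordinates is a
  best approximation, and the error of approximation by finite combinations is arbitrarily small.
\<close>
lemma norm_sq_le_of_finite_sums:
  assumes B: "\<And>F. finite F \<Longrightarrow> F \<subseteq> N \<Longrightarrow> (\<Sum>k\<in>F. (x \<bullet> e k)\<^sup>2) \<le> B"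
  shows "(norm x)\<^sup>2 \<le> B"
proof (rule field_le_epsilon)
  fix \<epsilon> :: real assume "0 < \<epsilon>"
  then obtain F v where F: "finite F" "F \<subseteq> N" "v \<in> span (e ` F)" "norm (x - v) < sqrt \<epsilon>"
    using finite_span_approx[of "sqrt \<epsilon>"] by auto
  define P where "P = (\<Sum>k\<in>F. (x \<bullet> e k) *\<^sub>R e k)"
  have P: "P \<in> span (e ` F)" unfolding P_def by (intro span_sum span_scale span_base) auto
  have orth: "(x - P) \<bullet> w = 0" if "w \<in> span (e ` F)" for w
  proof -
    have "(x - P) \<bullet> e j = 0" if "j \<in> F" for j
    proof -
      have "P \<bullet> e j = (\<Sum>k\<in>F. if k = j then x \<bullet> e k else 0)"
        unfolding P_def inner_sum_left using that F(2)
        by (intro sum.cong) (auto simp: inner_basis subset_iff)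
      then show ?thesis using that F(1) by (simp add: inner_diff_left)
    qed
    then have "orthogonal (x - P) w"
      by (intro orthogonal_to_span[OF that]) (auto simp: orthogonal_def)
    then show ?thesis by (simp add: orthogonal_def)
  qed
  have "(norm x)\<^sup>2 = (norm (x - P))\<^sup>2 + x \<bullet> P"
    using orth[OF P] by (simp add: power2_norm_eq_inner inner_diff_left inner_diff_right inner_commute)
  also have "x \<bullet> P = (\<Sum>k\<in>F. (x \<bullet> e k)\<^sup>2)"
    by (simp add: P_def inner_sum_right power2_eq_square)
  also have "\<dots> \<le> B" using B F by simp
  also have "(norm (x - P))\<^sup>2 \<le> (norm (x - v))\<^sup>2"
  proof -
    have "(norm (x - v))\<^sup>2 = (norm (x - P))\<^sup>2 + (norm (P - v))\<^sup>2"
      using orth[OF span_diff[OF P F(3)]]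
      by (simp add: power2_norm_eq_inner inner_diff_left inner_diff_right inner_commute)
    then show ?thesis by simp
  qed
  also have "(norm (x - v))\<^sup>2 \<le> \<epsilon>"
    using power_mono[of "norm (x - v)" "sqrt \<epsilon>" 2] F(4) \<open>0 < \<epsilon>\<close> by simp
  finally show "(norm x)\<^sup>2 \<le> B + \<epsilon>" by simp
qed

end

section \<open>Separable penalties that promote sparsity\<close>

text \<open>
  The bound \<open>\<sigma>_ge\<close> makes every sublevel set of the penalty bounded in the \<open>l1\<close> norm, and it is also
  what makes the proximal map send small coordinates to zero.
\<close>
locale sparse_penalty = hilbert_basis N e for N and e :: "nat \<Rightarrow> 'a::{real_inner, complete_space}" +
  fixes \<sigma> :: "nat \<Rightarrow> real \<Rightarrow> real" and \<omega> p :: real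
  assumes p: "1 < p" and \<omega>: "0 < \<omega>"
    and \<sigma>_convex: "k \<in> N \<Longrightarrow> convex_on UNIV (\<sigma> k)"
    and \<sigma>_ge: "k \<in> N \<Longrightarrow> \<omega> * \<bar>t\<bar> \<le> \<sigma> k t"
    and \<sigma>_zero: "k \<in> N \<Longrightarrow> \<sigma> k 0 = 0"
begin

definition \<phi> :: "nat \<Rightarrow> real \<Rightarrow> real" where
  "\<phi> k t = \<sigma> k t + \<bar>t\<bar> powr p / p"

definition dom_G :: "'a set" where
  "dom_G = {z. (\<lambda>k. \<phi> k (z \<bullet> e k)) summable_on N}"

definition G :: "'a \<Rightarrow> real" where
  "G z = (\<Sum>\<^sub>\<infinity>k\<in>N. \<phi> k (z \<bullet> e k))"

lemma \<phi>_ge: "k \<in> N \<Longrightarrow> \<omega> * \<bar>t\<bar> \<le> \<phi> k t"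
  using \<sigma>_ge[of k t] p by (simp add: \<phi>_def add_increasing2)

lemma \<phi>_nonneg: "k \<in> N \<Longrightarrow> 0 \<le> \<phi> k t"
  using \<phi>_ge[of k t] \<omega> by (meson abs_ge_zero mult_nonneg_nonneg order_less_imp_le order_trans)

lemma \<phi>_zero: "k \<in> N \<Longrightarrow> \<phi> k 0 = 0"
  by (simp add: \<phi>_def \<sigma>_zero)

lemma \<phi>_convex: "k \<in> N \<Longrightarrow> convex_on UNIV (\<phi> k)"
  unfolding \<phi>_def [abs_def] using \<sigma>_convex p
  by (intro convex_on_add convex_on_cdiv convex_on_abs_powr) auto

lemma \<phi>_midpoint:
  assumes "k \<in> N" and "\<bar>(a + b) / 2\<bar> powr p + w \<le> (\<bar>a\<bar> powr p + \<bar>b\<bar> powr p) / 2"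
  shows "\<phi> k ((a + b) / 2) + w / p \<le> (\<phi> k a + \<phi> k b) / 2"
proof -
  have "\<sigma> k ((1 - 1/2) *\<^sub>R a + (1/2) *\<^sub>R b) \<le> (1 - 1/2) * \<sigma> k a + (1/2) * \<sigma> k b"
    by (rule convex_onD[OF \<sigma>_convex]) (use assms in auto)
  moreover have "(1 - 1/2) *\<^sub>R a + (1/2) *\<^sub>R b = (a + b) / 2" by (simp add: field_simps)
  moreover have "(\<bar>(a + b) / 2\<bar> powr p + w) / p \<le> ((\<bar>a\<bar> powr p + \<bar>b\<bar> powr p) / 2) / p"
    using assms p by (intro divide_right_mono) auto
  ultimately have "\<sigma> k ((a + b) / 2) \<le> (1 - 1/2) * \<sigma> k a + (1/2) * \<sigma> k b"
    and "\<bar>(a + b) / 2\<bar> powr p / p + w / p \<le> \<bar>a\<bar> powr p / p / 2 + \<bar>b\<bar> powr p / p / 2"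
    by (simp_all only: add_divide_distrib divide_divide_eq_left mult.commute)
  then show ?thesis unfolding \<phi>_def by argo
qed

lemma sum_\<phi>_le_G:
  assumes "z \<in> dom_G" "finite F" "F \<subseteq> N"
  shows "(\<Sum>k\<in>F. \<phi> k (z \<bullet> e k)) \<le> G z"
  unfolding G_def using assms \<phi>_nonneg
  by (intro finite_sum_le_infsum) (auto simp: dom_G_def)

text \<open>
  Since all terms are nonnegative, both finiteness of the penalty and upper bounds on it can be
  tested on finite sets of coordinates; all later estimates of \<open>G\<close> from above go through this lemma.
\<close>
lemma G_le_of_finite_sums:
  assumes "\<And>F. finite F \<Longrightarrow> F \<subseteq> N \<Longrightarrow> (\<Sum>k\<in>F. \<phi> k (z \<bullet> e k)) \<le> M"
  shows "z \<in> dom_G" "G z \<le> M"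
proof -
  show *: "z \<in> dom_G" unfolding dom_G_def mem_Collect_eq
    by (rule nonneg_bdd_above_summable_on)
      (use assms \<phi>_nonneg in \<open>auto simp: bdd_above_def\<close>)
  show "G z \<le> M" unfolding G_def using * assms
    by (intro infsum_le_finite_sums) (auto simp: dom_G_def)
qed

lemma zero_in_dom_G: "0 \<in> dom_G" "G 0 \<le> 0"
  by (rule G_le_of_finite_sums[where M = 0]; simp add: \<phi>_zero subset_iff sum.neutral)+

lemma G_nonneg: "z \<in> dom_G \<Longrightarrow> 0 \<le> G z"
  using sum_\<phi>_le_G[of z "{}"] by simp

lemma sum_abs_le_G:
  assumes "z \<in> dom_G" "finite F" "F \<subseteq> N"
  shows "(\<Sum>k\<in>F. \<bar>z \<bullet> e k\<bar>) \<le> G z / \<omega>"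
proof -
  have "\<omega> * (\<Sum>k\<in>F. \<bar>z \<bullet> e k\<bar>) \<le> (\<Sum>k\<in>F. \<phi> k (z \<bullet> e k))"
    unfolding sum_distrib_left using assms \<phi>_ge by (intro sum_mono) auto
  also have "\<dots> \<le> G z" by (rule sum_\<phi>_le_G[OF assms])
  finally show ?thesis using \<omega> by (simp add: field_simps)
qed

text \<open>
  A sublevel set is the intersection, over finite sets of coordinates, of sublevel sets of continuous
  functions.
\<close>
lemma closed_sublevel_G: "closed {z \<in> dom_G. G z \<le> M}"
proof -
  have eq: "{z \<in> dom_G. G z \<le> M}
    = (\<Inter>F\<in>{F. finite F \<and> F \<subseteq> N}. {z. (\<Sum>k\<in>F. \<phi> k (z \<bullet> e k)) \<le> M})"
  proof (intro equalityI subsetI)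
    fix z assume "z \<in> {z \<in> dom_G. G z \<le> M}"
    then show "z \<in> (\<Inter>F\<in>{F. finite F \<and> F \<subseteq> N}. {z. (\<Sum>k\<in>F. \<phi> k (z \<bullet> e k)) \<le> M})"
      using sum_\<phi>_le_G[of z] order_trans by blast
  next
    fix z assume "z \<in> (\<Inter>F\<in>{F. finite F \<and> F \<subseteq> N}. {z. (\<Sum>k\<in>F. \<phi> k (z \<bullet> e k)) \<le> M})"
    then show "z \<in> {z \<in> dom_G. G z \<le> M}"
      using G_le_of_finite_sums[of z M] by blast
  qed
  have "continuous_on UNIV (\<lambda>z. \<Sum>k\<in>F. \<phi> k (z \<bullet> e k))" if "F \<subseteq> N" for F
  proof (intro continuous_on_sum)
    fix k assume "k \<in> F"
    then have "continuous_on UNIV (\<phi> k)"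
      using that by (intro convex_on_continuous \<phi>_convex) auto
    then show "continuous_on UNIV (\<lambda>z. \<phi> k (z \<bullet> e k))"
      by (rule continuous_on_compose2) (auto intro!: continuous_intros)
  qed
  then show ?thesis unfolding eq by (intro closed_INT ballI closed_Collect_le) auto
qed

lemma G_convex:
  assumes x: "x \<in> dom_G" and u: "u \<in> dom_G" and t: "0 \<le> t" "t \<le> 1"
  shows "(1 - t) *\<^sub>R x + t *\<^sub>R u \<in> dom_G"
    and "G ((1 - t) *\<^sub>R x + t *\<^sub>R u) \<le> (1 - t) * G x + t * G u"
proof -
  have *: "(\<Sum>k\<in>F. \<phi> k (((1 - t) *\<^sub>R x + t *\<^sub>R u) \<bullet> e k)) \<le> (1 - t) * G x + t * G u"
    if F: "finite F" "F \<subseteq> N" for F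
  proof -
    have "(\<Sum>k\<in>F. \<phi> k (((1 - t) *\<^sub>R x + t *\<^sub>R u) \<bullet> e k))
        \<le> (\<Sum>k\<in>F. (1 - t) * \<phi> k (x \<bullet> e k) + t * \<phi> k (u \<bullet> e k))"
    proof (rule sum_mono)
      fix k assume "k \<in> F"
      then show "\<phi> k (((1 - t) *\<^sub>R x + t *\<^sub>R u) \<bullet> e k)
          \<le> (1 - t) * \<phi> k (x \<bullet> e k) + t * \<phi> k (u \<bullet> e k)"
        using convex_onD[OF \<phi>_convex, of k t "x \<bullet> e k" "u \<bullet> e k"] F t
        by (auto simp: inner_add_left)
    qed
    also have "\<dots> \<le> (1 - t) * G x + t * G u"
      unfolding sum.distrib sum_distrib_left[symmetric] using t F x u
      by (intro add_mono mult_left_mono sum_\<phi>_le_G) auto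
    finally show ?thesis .
  qed
  show "(1 - t) *\<^sub>R x + t *\<^sub>R u \<in> dom_G" by (rule G_le_of_finite_sums(1)[OF *])
  show "G ((1 - t) *\<^sub>R x + t *\<^sub>R u) \<le> (1 - t) * G x + t * G u"
    by (rule G_le_of_finite_sums(2)[OF *])
qed

text \<open>
  Gains \<open>w k\<close> in the scalar midpoint inequalities of \<open>\<bar>t\<bar> powr p\<close> add up over the coordinates, while the
  convex functions \<open>\<sigma> k\<close> contribute no loss.
\<close>
lemma G_midpoint_gap:
  assumes x: "x \<in> dom_G" and u: "u \<in> dom_G" and F: "finite F" "F \<subseteq> N"
    and w_nonneg: "\<And>k. k \<in> N \<Longrightarrow> 0 \<le> w k"
    and w: "\<And>k. k \<in> N \<Longrightarrow> \<bar>(x \<bullet> e k + u \<bullet> e k) / 2\<bar> powr p + w k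
        \<le> (\<bar>x \<bullet> e k\<bar> powr p + \<bar>u \<bullet> e k\<bar> powr p) / 2"
  shows "(1/2) *\<^sub>R (x + u) \<in> dom_G"
    and "G ((1/2) *\<^sub>R (x + u)) + (\<Sum>k\<in>F. w k) / p \<le> (G x + G u) / 2"
proof -
  define m where "m = (1/2) *\<^sub>R (x + u)"
  have m: "m \<bullet> e k = (x \<bullet> e k + u \<bullet> e k) / 2" for k
    by (simp add: m_def inner_add_left)
  have *: "(\<Sum>k\<in>F'. \<phi> k (m \<bullet> e k)) \<le> (G x + G u) / 2 - (\<Sum>k\<in>F. w k) / p"
    if F': "finite F'" "F' \<subseteq> N" for F'
  proof -
    let ?U = "F \<union> F'"
    have U: "finite ?U" "?U \<subseteq> N" using F F' by auto
    have "(\<Sum>k\<in>F'. \<phi> k (m \<bullet> e k)) \<le> (\<Sum>k\<in>?U. \<phi> k (m \<bullet> e k))"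
      using U \<phi>_nonneg by (intro sum_mono2) auto
    moreover have "(\<Sum>k\<in>F. w k / p) \<le> (\<Sum>k\<in>?U. w k / p)"
      using U w_nonneg p by (intro sum_mono2) auto
    moreover have "(\<Sum>k\<in>?U. \<phi> k (m \<bullet> e k)) + (\<Sum>k\<in>?U. w k / p)
        \<le> (\<Sum>k\<in>?U. (\<phi> k (x \<bullet> e k) + \<phi> k (u \<bullet> e k)) / 2)"
      unfolding sum.distrib[symmetric] m using U w by (intro sum_mono \<phi>_midpoint) auto
    moreover have "\<dots> \<le> (G x + G u) / 2"
      unfolding sum_divide_distrib[symmetric] sum.distrib
      using sum_\<phi>_le_G[OF x U] sum_\<phi>_le_G[OF u U] by simp
    ultimately show ?thesis unfolding sum_divide_distrib by linarith
  qed
  show "(1/2) *\<^sub>R (x + u) \<in> dom_G"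
    using G_le_of_finite_sums(1)[OF *] by (simp add: m_def)
  show "G ((1/2) *\<^sub>R (x + u)) + (\<Sum>k\<in>F. w k) / p \<le> (G x + G u) / 2"
    using G_le_of_finite_sums(2)[OF *] unfolding m_def by linarith
qed

lemma abs_coord_le:
  assumes "z \<in> dom_G" "k \<in> N"
  shows "\<bar>z \<bullet> e k\<bar> \<le> G z / \<omega>"
  using sum_abs_le_G[of z "{k}"] assms by simp

text \<open>
  On a sublevel set all coordinates lie in a common interval \<open>{- R..R}\<close>, where \<open>\<bar>t\<bar> powr p\<close> is strongly
  convex, so the gain is a multiple of the sum of the squares of the coordinates of \<open>x - u\<close>.
\<close>
lemma uniformly_midconvex_G_le2:
  assumes "p \<le> 2"
  shows "uniformly_midconvex dom_G G 2"
  unfolding uniformly_midconvex_def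
proof
  fix M :: real
  \<comment> \<open>The summand \<open>1\<close> keeps \<open>R\<close> positive when \<open>M = 0\<close>.\<close>
  define R where "R = \<bar>M\<bar> / \<omega> + 1"
  have R: "0 < R" using \<omega> by (simp add: R_def add_nonneg_pos)
  define \<kappa> where "\<kappa> = p * (p - 1) / 8 * R powr (p - 2)"
  have \<kappa>: "0 < \<kappa>" using p R by (simp add: \<kappa>_def)
  have "(1/2) *\<^sub>R (x + u) \<in> dom_G \<and>
      G ((1/2) *\<^sub>R (x + u)) + \<kappa> / p * norm (x - u) powr 2 \<le> (G x + G u) / 2"
    if x: "x \<in> dom_G" and u: "u \<in> dom_G" and M: "G x \<le> M" "G u \<le> M" for x u
  proof -
    have le_R: "\<bar>z \<bullet> e k\<bar> \<le> R" if "z \<in> dom_G" "G z \<le> M" "k \<in> N" for z k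
    proof -
      have "G z / \<omega> \<le> \<bar>M\<bar> / \<omega>" using that \<omega> by (intro divide_right_mono) auto
      then show ?thesis using abs_coord_le[OF that(1,3)] by (simp add: R_def)
    qed
    have w: "\<bar>(x \<bullet> e k + u \<bullet> e k) / 2\<bar> powr p + \<kappa> * ((x - u) \<bullet> e k)\<^sup>2
        \<le> (\<bar>x \<bullet> e k\<bar> powr p + \<bar>u \<bullet> e k\<bar> powr p) / 2" if "k \<in> N" for k
      unfolding \<kappa>_def inner_diff_left using le_R[OF x M(1) that] le_R[OF u M(2) that] assms p R
      by (intro powr_midpoint_strong) auto
    have w_nonneg: "0 \<le> \<kappa> * ((x - u) \<bullet> e k)\<^sup>2" for k using \<kappa> by simp
    have "(\<Sum>k\<in>F. ((x - u) \<bullet> e k)\<^sup>2) \<le> ((G x + G u) / 2 - G ((1/2) *\<^sub>R (x + u))) * p / \<kappa>"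
      if "finite F" "F \<subseteq> N" for F
    proof -
      have "(\<Sum>k\<in>F. \<kappa> * ((x - u) \<bullet> e k)\<^sup>2) / p
          \<le> (G x + G u) / 2 - G ((1/2) *\<^sub>R (x + u))"
        using G_midpoint_gap(2)[OF x u that w_nonneg w] by linarith
      then show ?thesis
        using \<kappa> p by (simp add: sum_distrib_left[symmetric] pos_le_divide_eq pos_divide_le_eq mult.commute)
    qed
    then have "(norm (x - u))\<^sup>2 \<le> ((G x + G u) / 2 - G ((1/2) *\<^sub>R (x + u))) * p / \<kappa>"
      by (rule norm_sq_le_of_finite_sums)
    then have "\<kappa> / p * norm (x - u) powr 2 \<le> (G x + G u) / 2 - G ((1/2) *\<^sub>R (x + u))"
    proof -
      have "\<kappa> * (norm (x - u))\<^sup>2 \<le> ((G x + G u) / 2 - G ((1/2) *\<^sub>R (x + u))) * p"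
        using \<open>_ \<le> _ * p / \<kappa>\<close> \<kappa> by (simp add: pos_le_divide_eq mult.commute)
      then show ?thesis using p by (simp add: pos_divide_le_eq)
    qed
    then have "G ((1/2) *\<^sub>R (x + u)) + \<kappa> / p * norm (x - u) powr 2 \<le> (G x + G u) / 2"
      by linarith
    then show ?thesis using G_midpoint_gap(1)[OF x u _ _ w_nonneg w, of "{}"] by blast
  qed
  then show "\<exists>c>0. \<forall>x\<in>dom_G. \<forall>u\<in>dom_G. G x \<le> M \<longrightarrow> G u \<le> M \<longrightarrow> (1/2) *\<^sub>R (x + u) \<in> dom_G \<and>
      G ((1/2) *\<^sub>R (x + u)) + c * norm (x - u) powr 2 \<le> (G x + G u) / 2"
    using \<kappa> p by (intro exI[of _ "\<kappa> / p"]) auto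
qed

text \<open>
  The case \<open>p \<ge> 2\<close>, for a bound \<open>B\<close> on either the \<open>l1\<close> norm of \<open>x - u\<close> (\<open>i = 1\<close>) or the number of its
  nonzero coordinates (\<open>i = 0\<close>).  The gain supplied by Clarkson's inequality is a multiple of the \<open>p\<close>-th
  power of the \<open>lp\<close> norm, which interpolation bounds below by a power of the Hilbert norm.  The sum in
  the hypothesis is restricted to nonzero coordinates so that \<open>i = 0\<close> counts the support.
\<close>
lemma G_gap_of_coordinate_bound:
  assumes p2: "2 \<le> p" and x: "x \<in> dom_G" and u: "u \<in> dom_G" and B: "0 < B" and i: "i < 2"
    and bound: "\<And>F. finite F \<Longrightarrow> F \<subseteq> N \<Longrightarrow>
      (\<Sum>k | k \<in> F \<and> (x - u) \<bullet> e k \<noteq> 0. \<bar>(x - u) \<bullet> e k\<bar> ^ i) \<le> B"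
  shows "(1/2) *\<^sub>R (x + u) \<in> dom_G"
    and "G ((1/2) *\<^sub>R (x + u)) +
      1 / (p * 2 powr p) * (1 / 2 * (1 / (2 * B)) powr ((p - 2) / real (2 - i)))
        * norm (x - u) powr (2 + 2 * (p - 2) / real (2 - i)) \<le> (G x + G u) / 2"
proof -
  define w where "w k = \<bar>(x \<bullet> e k - u \<bullet> e k) / 2\<bar> powr p" for k
  have w: "\<bar>(x \<bullet> e k + u \<bullet> e k) / 2\<bar> powr p + w k
        \<le> (\<bar>x \<bullet> e k\<bar> powr p + \<bar>u \<bullet> e k\<bar> powr p) / 2" for k
    unfolding w_def by (rule powr_midpoint_clarkson[OF p2])
  have w_nonneg: "0 \<le> w k" for k by (simp add: w_def)
  \<comment> \<open>An upper bound for the \<open>p\<close>-th power of the \<open>lp\<close> norm of \<open>x - u\<close>, see the fact \<open>P\<close> below.\<close>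
  define P where "P = p * 2 powr p * ((G x + G u) / 2 - G ((1/2) *\<^sub>R (x + u)))"
  note gap = G_midpoint_gap[OF x u _ _ w_nonneg w]
  have P: "(\<Sum>k\<in>F. \<bar>(x - u) \<bullet> e k\<bar> powr p) \<le> P" if "finite F" "F \<subseteq> N" for F
  proof -
    have "(\<Sum>k\<in>F. w k) = (\<Sum>k\<in>F. \<bar>(x - u) \<bullet> e k\<bar> powr p) / 2 powr p"
      by (simp add: w_def powr_divide sum_divide_distrib inner_diff_left)
    moreover have "(\<Sum>k\<in>F. w k) \<le> p * ((G x + G u) / 2 - G ((1/2) *\<^sub>R (x + u)))"
    proof -
      have "(\<Sum>k\<in>F. w k) / p \<le> (G x + G u) / 2 - G ((1/2) *\<^sub>R (x + u))"
        using gap(2)[OF that] by linarith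
      then show ?thesis using p by (simp add: pos_divide_le_eq mult.commute)
    qed
    ultimately show ?thesis by (simp add: P_def pos_divide_le_eq mult_ac)
  qed
  have "1 / 2 * (1 / (2 * B)) powr ((p - 2) / real (2 - i))
      * norm (x - u) powr (2 + 2 * (p - 2) / real (2 - i)) \<le> P"
  proof (rule powr_le_of_interpolation[OF p2 _ B])
    fix s :: real assume s: "0 < s"
    show "(norm (x - u))\<^sup>2 \<le> B * s powr real (2 - i) + s powr (2 - p) * P"
    proof (rule norm_sq_le_of_finite_sums)
      fix F assume F: "finite F" "F \<subseteq> N"
      let ?F = "{k. k \<in> F \<and> (x - u) \<bullet> e k \<noteq> 0}"
      have F': "finite ?F" "?F \<subseteq> N" using F by auto
      have "(\<Sum>k\<in>F. ((x - u) \<bullet> e k)\<^sup>2) = (\<Sum>k\<in>?F. \<bar>(x - u) \<bullet> e k\<bar>\<^sup>2)"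
        using F by (intro sum.mono_neutral_cong_right) auto
      also have "\<dots> \<le> (\<Sum>k\<in>?F. s ^ (2 - i) * \<bar>(x - u) \<bullet> e k\<bar> ^ i
          + s powr (2 - p) * \<bar>(x - u) \<bullet> e k\<bar> powr p)"
        using s p2 i by (intro sum_mono square_le_power_plus_powr) auto
      also have "\<dots> = s ^ (2 - i) * (\<Sum>k\<in>?F. \<bar>(x - u) \<bullet> e k\<bar> ^ i)
          + s powr (2 - p) * (\<Sum>k\<in>?F. \<bar>(x - u) \<bullet> e k\<bar> powr p)"
        by (simp add: sum.distrib sum_distrib_left)
      also have "\<dots> \<le> s ^ (2 - i) * B + s powr (2 - p) * P"
        using s bound[OF F] P[OF F'] by (intro add_mono mult_left_mono) auto
      also have "s ^ (2 - i) = s powr real (2 - i)" using s by (simp add: powr_realpow)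
      finally show "(\<Sum>k\<in>F. ((x - u) \<bullet> e k)\<^sup>2) \<le> B * s powr real (2 - i) + s powr (2 - p) * P"
        by (simp add: mult.commute)
    qed
  qed (use i P[of "{}"] in auto)
  then show "G ((1/2) *\<^sub>R (x + u)) +
      1 / (p * 2 powr p) * (1 / 2 * (1 / (2 * B)) powr ((p - 2) / real (2 - i)))
        * norm (x - u) powr (2 + 2 * (p - 2) / real (2 - i)) \<le> (G x + G u) / 2"
    using p unfolding P_def by (simp add: field_simps)
  show "(1/2) *\<^sub>R (x + u) \<in> dom_G" using gap(1)[of "{}"] by simp
qed

lemma uniformly_midconvex_G_ge2:
  assumes p2: "2 \<le> p"
  shows "uniformly_midconvex dom_G G (2 * (p - 1))"
  unfolding uniformly_midconvex_def
proof
  fix M :: real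
  define B where "B = 2 * \<bar>M\<bar> / \<omega> + 1"
  have B: "0 < B" using \<omega> by (simp add: B_def add_nonneg_pos)
  have bound: "(\<Sum>k | k \<in> F \<and> (x - u) \<bullet> e k \<noteq> 0. \<bar>(x - u) \<bullet> e k\<bar> ^ 1) \<le> B"
    if "x \<in> dom_G" "u \<in> dom_G" "G x \<le> M" "G u \<le> M" "finite F" "F \<subseteq> N" for x u F
  proof -
    have "(\<Sum>k | k \<in> F \<and> (x - u) \<bullet> e k \<noteq> 0. \<bar>(x - u) \<bullet> e k\<bar> ^ 1)
        \<le> (\<Sum>k\<in>F. \<bar>(x - u) \<bullet> e k\<bar> ^ 1)"
      using that(5) by (intro sum_mono2) auto
    also have "\<dots> \<le> (\<Sum>k\<in>F. \<bar>x \<bullet> e k\<bar> + \<bar>u \<bullet> e k\<bar>)"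
      unfolding inner_diff_left power_one_right by (intro sum_mono abs_triangle_ineq4)
    also have "\<dots> \<le> G x / \<omega> + G u / \<omega>"
      unfolding sum.distrib using that by (intro add_mono sum_abs_le_G) auto
    also have "\<dots> \<le> \<bar>M\<bar> / \<omega> + \<bar>M\<bar> / \<omega>"
      using that \<omega> by (intro add_mono divide_right_mono) auto
    finally show ?thesis by (simp add: B_def)
  qed
  have q: "2 + 2 * (p - 2) / real (2 - 1) = 2 * (p - 1)" by simp
  define c where "c = 1 / (p * 2 powr p) * (1 / 2 * (1 / (2 * B)) powr ((p - 2) / real (2 - 1)))"
  have "(1/2) *\<^sub>R (x + u) \<in> dom_G \<and>
      G ((1/2) *\<^sub>R (x + u)) + c * norm (x - u) powr (2 * (p - 1)) \<le> (G x + G u) / 2"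
    if "x \<in> dom_G" "u \<in> dom_G" "G x \<le> M" "G u \<le> M" for x u
    using G_gap_of_coordinate_bound[OF p2 that(1,2) B _ bound[OF that], unfolded q, folded c_def]
    by simp
  moreover have "0 < c" using p B by (simp add: c_def)
  ultimately show "\<exists>c>0. \<forall>x\<in>dom_G. \<forall>u\<in>dom_G. G x \<le> M \<longrightarrow> G u \<le> M \<longrightarrow>
      (1/2) *\<^sub>R (x + u) \<in> dom_G \<and>
      G ((1/2) *\<^sub>R (x + u)) + c * norm (x - u) powr (2 * (p - 1)) \<le> (G x + G u) / 2" by blast
qed

text \<open>
  On vectors with support in a fixed finite set the norms are equivalent, which improves the exponent
  \<open>2 * (p - 1)\<close> of the general case to \<open>p\<close>.
\<close>
lemma uniformly_midconvex_G_finite_support: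
  assumes p2: "2 \<le> p" and K: "finite K"
  shows "uniformly_midconvex {z \<in> dom_G. \<forall>k\<in>N - K. z \<bullet> e k = 0} G p"
  unfolding uniformly_midconvex_def
proof
  fix M :: real
  define B where "B = real (card K) + 1"
  have B: "0 < B" by (simp add: B_def add_nonneg_pos)
  have bound: "(\<Sum>k | k \<in> F \<and> (x - u) \<bullet> e k \<noteq> 0. \<bar>(x - u) \<bullet> e k\<bar> ^ 0) \<le> B"
    if "\<forall>k\<in>N - K. x \<bullet> e k = 0" "\<forall>k\<in>N - K. u \<bullet> e k = 0" "finite F" "F \<subseteq> N" for x u F
  proof -
    have "{k. k \<in> F \<and> (x - u) \<bullet> e k \<noteq> 0} \<subseteq> K" using that by (force simp: inner_diff_left)
    then have "card {k. k \<in> F \<and> (x - u) \<bullet> e k \<noteq> 0} \<le> card K" using K by (rule card_mono[rotated])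
    then show ?thesis by (simp add: B_def)
  qed
  have q: "2 + 2 * (p - 2) / real (2 - 0) = p" by (simp add: field_simps)
  define c where "c = 1 / (p * 2 powr p) * (1 / 2 * (1 / (2 * B)) powr ((p - 2) / real (2 - 0)))"
  let ?S = "{z \<in> dom_G. \<forall>k\<in>N - K. z \<bullet> e k = 0}"
  have "(1/2) *\<^sub>R (x + u) \<in> ?S \<and>
      G ((1/2) *\<^sub>R (x + u)) + c * norm (x - u) powr p \<le> (G x + G u) / 2"
    if "x \<in> ?S" "u \<in> ?S" for x u
  proof -
    have xu: "x \<in> dom_G" "u \<in> dom_G" "\<forall>k\<in>N - K. x \<bullet> e k = 0" "\<forall>k\<in>N - K. u \<bullet> e k = 0"
      using that by auto
    show ?thesis
      using G_gap_of_coordinate_bound[OF p2 xu(1,2) B _ bound[OF xu(3,4)], unfolded q, folded c_def]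
        xu(3,4) by (simp add: inner_add_left)
  qed
  moreover have "0 < c" using p B by (simp add: c_def)
  ultimately show "\<exists>c>0. \<forall>x\<in>?S. \<forall>u\<in>?S. G x \<le> M \<longrightarrow> G u \<le> M \<longrightarrow>
      (1/2) *\<^sub>R (x + u) \<in> ?S \<and>
      G ((1/2) *\<^sub>R (x + u)) + c * norm (x - u) powr p \<le> (G x + G u) / 2" by blast
qed

text \<open>
  Soft thresholding: replacing the coordinate \<open>t = z \<bullet> e k\<close> of the proximal point by \<open>0\<close> lowers the penalty
  by at least \<open>\<omega> * \<bar>t\<bar>\<close>.  When \<open>\<bar>v \<bullet> e k\<bar> \<le> lam * \<omega>\<close> the quadratic term cannot make up for this, so minimality
  forces \<open>t = 0\<close>.
\<close>
lemma prox_coordinate_zero: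
  assumes z: "z \<in> dom_G" and lam: "0 < lam" and k: "k \<in> N" and small: "\<bar>v \<bullet> e k\<bar> \<le> lam * \<omega>"
    and min: "\<And>u. u \<in> dom_G \<Longrightarrow>
      G z + 1 / (2 * lam) * (norm (z - v))\<^sup>2 \<le> G u + 1 / (2 * lam) * (norm (u - v))\<^sup>2"
  shows "z \<bullet> e k = 0"
proof -
  define t where "t = z \<bullet> e k"
  define u where "u = z - t *\<^sub>R e k"
  have u_coord: "u \<bullet> e j = (if j = k then 0 else z \<bullet> e j)" if "j \<in> N" for j
    using that k by (simp add: u_def t_def inner_diff_left inner_basis)
  have "(\<Sum>j\<in>F. \<phi> j (u \<bullet> e j)) \<le> G z - \<phi> k t" if F: "finite F" "F \<subseteq> N" for F
  proof -
    have "(\<Sum>j\<in>F. \<phi> j (u \<bullet> e j)) = (\<Sum>j\<in>F - {k}. \<phi> j (z \<bullet> e j))"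
      using F by (intro sum.mono_neutral_cong_right) (auto simp: u_coord \<phi>_zero)
    also have "\<dots> + \<phi> k (z \<bullet> e k) = (\<Sum>j\<in>insert k F. \<phi> j (z \<bullet> e j))"
      using F by (simp add: sum.insert_remove)
    also have "\<dots> \<le> G z" using F k by (intro sum_\<phi>_le_G z) auto
    finally show ?thesis by (simp add: t_def)
  qed
  then have u: "u \<in> dom_G" "G u \<le> G z - \<phi> k t"
    using G_le_of_finite_sums by blast+
  have "(norm (u - v))\<^sup>2 = (norm (z - v))\<^sup>2 - 2 * t * ((z - v) \<bullet> e k) + t\<^sup>2 * (e k \<bullet> e k)"
    unfolding u_def power2_norm_eq_inner
    by (simp add: inner_diff_left inner_diff_right inner_commute power2_eq_square algebra_simps)
  also have "\<dots> = (norm (z - v))\<^sup>2 + 2 * t * (v \<bullet> e k) - t\<^sup>2"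
    using k by (simp add: inner_basis inner_diff_left t_def power2_eq_square algebra_simps)
  finally have nu: "(norm (u - v))\<^sup>2 = (norm (z - v))\<^sup>2 + 2 * t * (v \<bullet> e k) - t\<^sup>2" .
  have "\<phi> k t + 1 / (2 * lam) * t\<^sup>2 \<le> 1 / (2 * lam) * (2 * t * (v \<bullet> e k))"
    using min[OF u(1)] u(2) unfolding nu by (simp add: algebra_simps)
  also have "\<dots> = t * (v \<bullet> e k) / lam" using lam by (simp add: field_simps)
  also have "\<dots> \<le> \<bar>t\<bar> * (lam * \<omega>) / lam"
  proof (rule divide_right_mono)
    have "t * (v \<bullet> e k) \<le> \<bar>t\<bar> * \<bar>v \<bullet> e k\<bar>" by (simp flip: abs_mult)
    also have "\<dots> \<le> \<bar>t\<bar> * (lam * \<omega>)" using small by (intro mult_left_mono) auto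
    finally show "t * (v \<bullet> e k) \<le> \<bar>t\<bar> * (lam * \<omega>)" .
  qed (use lam in simp)
  also have "\<dots> = \<omega> * \<bar>t\<bar>" using lam by simp
  also have "\<dots> \<le> \<phi> k t" using \<phi>_ge[OF k] .
  finally have "t\<^sup>2 \<le> 0" using lam by (simp add: mult_le_0_iff divide_le_0_iff)
  then show ?thesis by (simp add: t_def)
qed

end

section \<open>The forward-backward iteration\<close>

text \<open>
  The iteration is described through the minimization problem that defines each proximal step, on the
  domain \<open>S\<close> where \<open>G\<close> is finite.  Only the points after the first one are
  assumed to lie in \<open>S\<close>, since \<open>G\<close> may be infinite at the starting point.
\<close>
locale forward_backward =
  fixes S :: "'a::real_inner set" and G H :: "'a \<Rightarrow> real" and D :: "'a \<Rightarrow> 'a"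
    and L lam :: real and x :: "nat \<Rightarrow> 'a" and xbar :: 'a
  assumes S_convex: "u \<in> S \<Longrightarrow> v \<in> S \<Longrightarrow> 0 \<le> t \<Longrightarrow> t \<le> 1 \<Longrightarrow> (1 - t) *\<^sub>R u + t *\<^sub>R v \<in> S"
    and G_convex: "u \<in> S \<Longrightarrow> v \<in> S \<Longrightarrow> 0 \<le> t \<Longrightarrow> t \<le> 1 \<Longrightarrow>
      G ((1 - t) *\<^sub>R u + t *\<^sub>R v) \<le> (1 - t) * G u + t * G v"
    and H_lower: "H z + D z \<bullet> (u - z) \<le> H u"
    and H_upper: "H u \<le> H z + D z \<bullet> (u - z) + L / 2 * (norm (u - z))\<^sup>2"
    and D_lipschitz: "norm (D z - D u) \<le> L * norm (z - u)"
    and L: "0 < L" and lam: "0 < lam" "lam < 2 / L"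
    and step_in: "x (Suc n) \<in> S"
    and step_min: "u \<in> S \<Longrightarrow>
      G (x (Suc n)) + 1 / (2 * lam) * (norm (x (Suc n) - (x n - lam *\<^sub>R D (x n))))\<^sup>2
        \<le> G u + 1 / (2 * lam) * (norm (u - (x n - lam *\<^sub>R D (x n))))\<^sup>2"
    and xbar_in: "xbar \<in> S"
    and xbar_min: "u \<in> S \<Longrightarrow> G xbar + H xbar \<le> G u + H u"
begin

definition gap :: "nat \<Rightarrow> real" where
  "gap n = (G (x n) + H (x n)) - (G xbar + H xbar)"

lemma gap_nonneg: "x n \<in> S \<Longrightarrow> 0 \<le> gap n"
  using xbar_min by (simp add: gap_def)

lemma x_in: "1 \<le> n \<Longrightarrow> x n \<in> S"
  using step_in[of "n - 1"] by simp

text \<open>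
  The first-order condition for the proximal step, i.e. that the scaled displacement is a subgradient of
  \<open>G\<close> at the new point: compare with the point at parameter \<open>t\<close> on the segment towards \<open>u\<close>, and
  let \<open>t\<close> tend to \<open>0\<close>.
\<close>
lemma prox_inequality:
  assumes u: "u \<in> S"
  shows "G (x (Suc n)) - G u
      \<le> (1 / lam) * ((x (Suc n) - (x n - lam *\<^sub>R D (x n))) \<bullet> (u - x (Suc n)))"
proof (rule ccontr)
  define v where "v = x n - lam *\<^sub>R D (x n)"
  define \<delta> where "\<delta> = G (x (Suc n)) - G u - (1 / lam) * ((x (Suc n) - v) \<bullet> (u - x (Suc n)))"
  define C where "C = (norm (u - x (Suc n)))\<^sup>2 / (2 * lam)"
  have C: "0 \<le> C" using lam by (simp add: C_def)
  assume "\<not> ?thesis"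
  then have \<delta>: "0 < \<delta>" by (simp add: \<delta>_def v_def)
  have le: "\<delta> \<le> t * C" if t: "0 < t" "t \<le> 1" for t
  proof -
    define w where "w = (1 - t) *\<^sub>R x (Suc n) + t *\<^sub>R u"
    have w: "w - v = (x (Suc n) - v) + t *\<^sub>R (u - x (Suc n))"
      by (simp add: w_def algebra_simps)
    have "(norm (w - v))\<^sup>2 = (norm (x (Suc n) - v))\<^sup>2
        + 2 * t * ((x (Suc n) - v) \<bullet> (u - x (Suc n))) + t\<^sup>2 * (norm (u - x (Suc n)))\<^sup>2"
      unfolding w power2_norm_eq_inner inner_add_left inner_add_right inner_scaleR_left
        inner_scaleR_right inner_commute[of "u - x (Suc n)" "x (Suc n) - v"]
      by (simp add: power2_eq_square algebra_simps)
    then have nw: "1 / (2 * lam) * (norm (w - v))\<^sup>2 = 1 / (2 * lam) * (norm (x (Suc n) - v))\<^sup>2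
        + t * ((1 / lam) * ((x (Suc n) - v) \<bullet> (u - x (Suc n)))) + t * (t * C)"
      using lam by (simp add: C_def power2_eq_square field_simps)
    have "G (x (Suc n)) + 1 / (2 * lam) * (norm (x (Suc n) - v))\<^sup>2
        \<le> G w + 1 / (2 * lam) * (norm (w - v))\<^sup>2"
      unfolding v_def w_def using t u step_in by (intro step_min S_convex) auto
    also have "G w \<le> (1 - t) * G (x (Suc n)) + t * G u"
      unfolding w_def using t u step_in by (intro G_convex) auto
    finally have "t * \<delta> \<le> t * (t * C)"
      unfolding nw \<delta>_def by (simp add: algebra_simps)
    then show ?thesis using t by simp
  qed
  \<comment> \<open>Small enough for \<open>t * C < \<delta>\<close>, contradicting the inequality just proved.\<close>
  define t where "t = min 1 (\<delta> / (2 * (C + 1)))"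
  have t: "0 < t" "t \<le> 1" using \<delta> C by (auto simp: t_def)
  have "t * C \<le> \<delta> / (2 * (C + 1)) * C" using C by (intro mult_right_mono) (auto simp: t_def)
  also have "\<dots> < \<delta>" using \<delta> C by (simp add: field_simps add_strict_increasing2)
  finally show False using le[OF t] by simp
qed

definition decrease_const :: real where "decrease_const = 1 / lam - L / 2"
definition residual_const :: real where "residual_const = 1 / lam + L"

lemma decrease_const_pos: "0 < decrease_const" and residual_const_pos: "0 < residual_const"
  using L lam by (auto simp: decrease_const_def residual_const_def field_simps add_pos_pos)

text \<open>
  The first-order condition tested with the old point, combined with the descent lemma for \<open>H\<close>.  This is
  the place where \<open>lam < 2 / L\<close> enters, through the positivity of the constant.
\<close>
lemma descent:
  assumes "x n \<in> S"
  shows "decrease_const * (norm (x (Suc n) - x n))\<^sup>2 \<le> gap n - gap (Suc n)"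
proof -
  have "(1 / lam) * ((x (Suc n) - (x n - lam *\<^sub>R D (x n))) \<bullet> (x n - x (Suc n)))
     = - ((norm (x (Suc n) - x n))\<^sup>2 / lam) - D (x n) \<bullet> (x (Suc n) - x n)"
    using lam by (simp add: power2_norm_eq_inner algebra_simps inner_commute field_simps)
  then show ?thesis
    using prox_inequality[OF assms, of n] H_upper[of "x (Suc n)" "x n"]
    unfolding gap_def decrease_const_def by (simp add: algebra_simps)
qed

text \<open>
  The first-order condition tested with the minimizer, combined with the gradient inequality for \<open>H\<close> at the
  new point: up to the change of the gradient during the step, the displacement is a subgradient of the
  whole objective at the new point.
\<close>
lemma residual:
  "gap (Suc n) \<le> residual_const * norm (x (Suc n) - x n) * norm (x (Suc n) - xbar)"
proof -
  define w where "w = (1 / lam) *\<^sub>R (x (Suc n) - x n) + (D (x n) - D (x (Suc n)))"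
  have "gap (Suc n) \<le> (1 / lam) * ((x (Suc n) - (x n - lam *\<^sub>R D (x n))) \<bullet> (xbar - x (Suc n)))
      - D (x (Suc n)) \<bullet> (xbar - x (Suc n))"
    using prox_inequality[OF xbar_in, of n] H_lower[of "x (Suc n)" xbar]
    unfolding gap_def by linarith
  also have "\<dots> = w \<bullet> (xbar - x (Suc n))"
    using lam by (simp add: w_def inner_add_left inner_diff_left distrib_left right_diff_distrib)
  also have "\<dots> \<le> norm w * norm (xbar - x (Suc n))" by (rule norm_cauchy_schwarz)
  also have "norm w \<le> residual_const * norm (x (Suc n) - x n)"
  proof -
    have "norm w \<le> norm ((1 / lam) *\<^sub>R (x (Suc n) - x n)) + norm (D (x n) - D (x (Suc n)))"
      unfolding w_def by (rule norm_triangle_ineq)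
    also have "\<dots> \<le> norm (x (Suc n) - x n) / lam + L * norm (x (Suc n) - x n)"
      using D_lipschitz[of "x n" "x (Suc n)"] lam by (simp add: norm_minus_commute)
    finally show ?thesis by (simp add: residual_const_def algebra_simps)
  qed
  finally show ?thesis by (simp add: mult_right_mono norm_minus_commute)
qed

lemma gap_decr: "x n \<in> S \<Longrightarrow> gap (Suc n) \<le> gap n"
  using descent[of n] decrease_const_pos by (smt (verit) mult_nonneg_nonneg zero_le_power2)

lemma objective_le_first:
  assumes "1 \<le> n"
  shows "G (x n) + H (x n) \<le> G (x 1) + H (x 1)"
proof -
  have "gap n \<le> gap 1"
    using assms by (induction n rule: dec_induct) (auto intro: order_trans[OF gap_decr[OF x_in]])
  then show ?thesis by (simp add: gap_def)
qed

lemma growth_bound: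
  assumes c: "0 < c" and q: "0 < q" and growth: "c * norm (x n - xbar) powr q \<le> gap n"
  shows "norm (x n - xbar) \<le> (gap n / c) powr (1 / q)"
proof -
  have "(norm (x n - xbar) powr q) powr (1 / q) \<le> (gap n / c) powr (1 / q)"
    using growth c q by (intro powr_mono2) (auto simp: field_simps)
  then show ?thesis using q by (simp add: powr_powr)
qed

text \<open>
  Growth bounds the distance in \<open>residual\<close> by a power of the gap, and \<open>descent\<close> bounds the step length by
  the decrease of the gap.
\<close>
lemma recursion:
  assumes "x n \<in> S" and c: "0 < c" and q: "2 \<le> q"
    and growth: "c * norm (x (Suc n) - xbar) powr q \<le> gap (Suc n)"
  shows "gap (Suc n) powr (2 - 2 / q)
      \<le> residual_const\<^sup>2 / (decrease_const * c powr (2 / q)) * (gap n - gap (Suc n))"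
proof (cases "gap (Suc n) = 0")
  case True
  then show ?thesis using gap_nonneg[OF assms(1)] decrease_const_pos by simp
next
  case False
  let ?gap = "gap (Suc n)" and ?d = "norm (x (Suc n) - xbar)" and ?s = "norm (x (Suc n) - x n)"
  have gap: "0 < ?gap" using False gap_nonneg[OF step_in, of n] by simp
  have "?gap powr (2 - 2 / q) * ?gap powr (2 / q) = ?gap\<^sup>2"
    using gap by (simp flip: powr_add)
  also have "\<dots> \<le> (residual_const * ?s * ?d)\<^sup>2"
    using residual gap by (intro power_mono) auto
  also have "\<dots> = residual_const\<^sup>2 * ?s\<^sup>2 * ?d\<^sup>2" by (simp add: power_mult_distrib)
  also have "\<dots> \<le> residual_const\<^sup>2 * ?s\<^sup>2 * (?gap powr (2 / q) / c powr (2 / q))"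
  proof (rule mult_left_mono)
    have "?d\<^sup>2 \<le> ((?gap / c) powr (1 / q))\<^sup>2"
      using growth_bound[OF c _ growth] q by (intro power_mono) auto
    also have "\<dots> = ((?gap / c) powr (1 / q)) powr 2" by simp
    also have "\<dots> = ?gap powr (2 / q) / c powr (2 / q)"
      using gap c by (subst powr_powr) (simp add: powr_divide)
    finally show "?d\<^sup>2 \<le> ?gap powr (2 / q) / c powr (2 / q)" .
  qed simp
  finally have "?gap powr (2 - 2 / q) * ?gap powr (2 / q)
      \<le> (residual_const\<^sup>2 * ?s\<^sup>2 / c powr (2 / q)) * ?gap powr (2 / q)" by simp
  then have "?gap powr (2 - 2 / q) \<le> residual_const\<^sup>2 * ?s\<^sup>2 / c powr (2 / q)"
    by (rule mult_right_le_imp_le) (use gap in simp)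
  also have "\<dots> = residual_const\<^sup>2 / (decrease_const * c powr (2 / q)) * (decrease_const * ?s\<^sup>2)"
    using decrease_const_pos by simp
  also have "\<dots> \<le> residual_const\<^sup>2 / (decrease_const * c powr (2 / q)) * (gap n - ?gap)"
    using descent[OF assms(1)] decrease_const_pos by (intro mult_left_mono) auto
  finally show ?thesis .
qed

text \<open>
  For \<open>q = 2\<close> the recursion reads \<open>gap (n + 1) \<le> K * (gap n - gap (n + 1))\<close>, a contraction with factor
  \<open>K / (1 + K)\<close>.  It also holds for the first step when the starting point has finite objective value, since
  growth is needed at the new point only.
\<close>
lemma linear_rate:
  assumes c: "0 < c" and growth: "\<And>n. 1 \<le> n \<Longrightarrow> c * norm (x n - xbar) powr 2 \<le> gap n"
  obtains \<epsilon> C where "0 < \<epsilon>" "\<epsilon> < 1" "0 < C"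
    "\<And>n. x n \<in> S \<Longrightarrow> gap (Suc n) \<le> \<epsilon> * gap n"
    "\<And>n. norm (x (Suc n) - xbar) \<le> C * sqrt \<epsilon> ^ n"
proof -
  define K where "K = residual_const\<^sup>2 / (decrease_const * c)"
  have K: "0 < K" using decrease_const_pos residual_const_pos c by (simp add: K_def)
  define \<epsilon> where "\<epsilon> = K / (1 + K)"
  have \<epsilon>: "0 < \<epsilon>" "\<epsilon> < 1" using K by (simp_all add: \<epsilon>_def)
  have contr: "gap (Suc n) \<le> \<epsilon> * gap n" if "x n \<in> S" for n
  proof -
    have "gap (Suc n) \<le> K * (gap n - gap (Suc n))"
      using recursion[OF that c _ growth] gap_nonneg[OF step_in, of n] c by (simp add: K_def)
    then have "gap (Suc n) * (1 + K) \<le> K * gap n" by (simp add: algebra_simps)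
    then show ?thesis using K by (simp add: \<epsilon>_def pos_le_divide_eq)
  qed
  have gap_le: "gap (Suc n) \<le> \<epsilon> ^ n * gap 1" for n
  proof (induction n)
    case (Suc n)
    have "gap (Suc (Suc n)) \<le> \<epsilon> * gap (Suc n)" by (rule contr[OF step_in])
    also have "\<dots> \<le> \<epsilon> * (\<epsilon> ^ n * gap 1)" using Suc \<epsilon> by (intro mult_left_mono) auto
    finally show ?case by (simp add: mult.assoc)
  qed simp
  \<comment> \<open>The summand \<open>1\<close> keeps the constant positive when the first iterate is already optimal.\<close>
  have "norm (x (Suc n) - xbar) \<le> (sqrt (gap 1 / c) + 1) * sqrt \<epsilon> ^ n" for n
  proof -
    have "norm (x (Suc n) - xbar) \<le> sqrt (gap (Suc n) / c)"
      using growth_bound[OF c _ growth, of "Suc n"] gap_nonneg[OF step_in, of n] c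
      by (simp add: powr_half_sqrt)
    also have "\<dots> \<le> sqrt (\<epsilon> ^ n * gap 1 / c)"
      using gap_le c by (intro real_sqrt_le_mono divide_right_mono) auto
    also have "\<dots> = sqrt (gap 1 / c) * sqrt \<epsilon> ^ n"
      by (simp add: real_sqrt_mult real_sqrt_divide real_sqrt_power)
    also have "\<dots> \<le> (sqrt (gap 1 / c) + 1) * sqrt \<epsilon> ^ n"
      using \<epsilon> by (intro mult_right_mono) auto
    finally show ?thesis .
  qed
  moreover have "0 < sqrt (gap 1 / c) + 1"
    using gap_nonneg[OF step_in, of 0] c by (simp add: add_nonneg_pos)
  ultimately show ?thesis using that \<epsilon> contr by blast
qed

lemma polynomial_rates:
  assumes c: "0 < c" and q: "2 < q" and n0: "1 \<le> n0"
    and growth: "\<And>n. n0 \<le> n \<Longrightarrow> c * norm (x n - xbar) powr q \<le> gap n"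
  obtains C1 C2 where "0 < C1" "0 < C2"
    "\<And>n. 1 \<le> n \<Longrightarrow> gap n \<le> C1 * real n powr (- (q / (q - 2)))"
    "\<And>n. 1 \<le> n \<Longrightarrow> norm (x (Suc n) - xbar) \<le> C2 * real n powr (- (1 / (q - 2)))"
proof -
  define \<theta> where "\<theta> = 1 - 2 / q"
  have \<theta>: "0 < \<theta>" "1 / \<theta> = q / (q - 2)" "1 + \<theta> = 2 - 2 / q" using q by (auto simp: \<theta>_def field_simps)
  define K where "K = residual_const\<^sup>2 / (decrease_const * c powr (2 / q))"
  have K: "0 < K" using decrease_const_pos residual_const_pos c by (simp add: K_def)
  have "gap (Suc n) powr (1 + \<theta>) \<le> K * (gap n - gap (Suc n))" if "n0 \<le> n" for n
    unfolding \<theta>(3) K_def using that n0 q c x_in by (intro recursion growth) auto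
  then obtain C1 where C1: "0 < C1" "\<And>n. 1 \<le> n \<Longrightarrow> gap n \<le> C1 * real n powr (- (q / (q - 2)))"
    using polynomial_rate[of \<theta> K gap n0] \<theta> K n0 gap_nonneg gap_decr x_in by auto
  define s where "s = 1 / (q - 2)"
  have s: "0 < s" using q by (simp add: s_def)
  \<comment> \<open>The sum covers the finitely many indices before growth becomes available.\<close>
  define C2 where "C2 = (C1 / c) powr (1 / q) + (\<Sum>i<n0. norm (x (Suc i) - xbar) * real i powr s)"
  have sum_nonneg: "0 \<le> (\<Sum>i<n0. norm (x (Suc i) - xbar) * real i powr s)"
    by (intro sum_nonneg) auto
  have C2_pos: "0 < C2" using sum_nonneg C1 c by (simp add: C2_def add_pos_nonneg)
  have "norm (x (Suc n) - xbar) \<le> C2 * real n powr (- s)" if n: "1 \<le> n" for n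
  proof (cases "n < n0")
    case True
    have "norm (x (Suc n) - xbar) = norm (x (Suc n) - xbar) * real n powr s * real n powr (- s)"
      using n by (simp flip: powr_add mult.assoc)
    also have "\<dots> \<le> (\<Sum>i<n0. norm (x (Suc i) - xbar) * real i powr s) * real n powr (- s)"
      using True by (intro mult_right_mono member_le_sum) auto
    also have "\<dots> \<le> C2 * real n powr (- s)"
      by (intro mult_right_mono) (auto simp: C2_def)
    finally show ?thesis .
  next
    case False
    have "norm (x (Suc n) - xbar) \<le> (gap (Suc n) / c) powr (1 / q)"
      using growth_bound[OF c _ growth] False q by simp
    also have "\<dots> \<le> (C1 * real (Suc n) powr (- (q / (q - 2))) / c) powr (1 / q)"
      using C1(2)[of "Suc n"] gap_nonneg[OF step_in, of n] c q
      by (intro powr_mono2 divide_right_mono) auto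
    also have "\<dots> \<le> (C1 * real n powr (- (q / (q - 2))) / c) powr (1 / q)"
      using C1(1) n c q by (intro powr_mono2 divide_right_mono mult_left_mono powr_mono2') auto
    also have "\<dots> = ((C1 / c) * real n powr (- (q / (q - 2)))) powr (1 / q)" by simp
    also have "\<dots> = (C1 / c) powr (1 / q) * real n powr (- (q / (q - 2)) * (1 / q))"
      using C1(1) c by (subst powr_mult) (auto simp: powr_powr)
    also have "- (q / (q - 2)) * (1 / q) = - s" using q by (simp add: s_def)
    also have "(C1 / c) powr (1 / q) * real n powr (- s) \<le> C2 * real n powr (- s)"
      using sum_nonneg by (intro mult_right_mono) (auto simp: C2_def)
    finally show ?thesis .
  qed
  then show ?thesis using that[OF C1(1) C2_pos C1(2)] by (simp add: s_def)
qed

end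

section \<open>Reduction of the extended-real problem to its finite part\<close>

lemma infsum_ereal_nonneg:
  fixes f :: "'i \<Rightarrow> real"
  assumes nonneg: "\<And>k. k \<in> N \<Longrightarrow> 0 \<le> f k"
  shows "(\<Sum>\<^sub>\<infinity>k\<in>N. ereal (f k)) = (if f summable_on N then ereal (\<Sum>\<^sub>\<infinity>k\<in>N. f k) else \<infinity>)"
proof -
  have sup: "(\<Sum>\<^sub>\<infinity>k\<in>N. ereal (f k)) = (SUP F\<in>{F. finite F \<and> F \<subseteq> N}. ereal (sum f F))"
    using nonneg by (subst nonneg_infsum_complete) auto
  show ?thesis
  proof (cases "f summable_on N")
    case True
    then show ?thesis unfolding sup using infsum_nonneg_is_SUPREMUM_ereal[OF True nonneg] by simp
  next
    case False
    have "(SUP F\<in>{F. finite F \<and> F \<subseteq> N}. ereal (sum f F)) = \<infinity>"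
    proof (rule ccontr)
      assume "(SUP F\<in>{F. finite F \<and> F \<subseteq> N}. ereal (sum f F)) \<noteq> \<infinity>"
      moreover have "ereal 0 \<le> (SUP F\<in>{F. finite F \<and> F \<subseteq> N}. ereal (sum f F))"
        by (rule SUP_upper2[of "{}"]) auto
      ultimately obtain B where B: "(SUP F\<in>{F. finite F \<and> F \<subseteq> N}. ereal (sum f F)) = ereal B"
        by (cases "SUP F\<in>{F. finite F \<and> F \<subseteq> N}. ereal (sum f F)") auto
      have "sum f F \<le> B" if "finite F" "F \<subseteq> N" for F
      proof -
        have "ereal (sum f F) \<le> ereal B" unfolding B[symmetric] by (rule SUP_upper) (use that in auto)
        then show ?thesis by simp
      qed
      then have "f summable_on N"
        by (intro nonneg_bdd_above_summable_on nonneg) (auto simp: bdd_above_def)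
      then show False using False by simp
    qed
    then show ?thesis unfolding sup using False by simp
  qed
qed

lemma argmin_extension:
  assumes "S \<noteq> {}"
  shows "argmin (\<lambda>z. if z \<in> S then ereal (F z) else \<infinity>) = {z \<in> S. \<forall>u\<in>S. F z \<le> F u}"
  using assms by (fastforce simp: argmin_def is_arg_min_linorder split: if_splits)

lemma support_function_interval:
  assumes \<omega>: "0 < \<omega>" and sub: "{-\<omega>..\<omega>} \<subseteq> J" and bdd: "bounded J"
  obtains \<sigma> where "\<And>t. support_function J t = ereal (\<sigma> t)" "convex_on UNIV \<sigma>"
    "\<And>t. \<omega> * \<bar>t\<bar> \<le> \<sigma> t" "\<sigma> 0 = 0"
proof -
  obtain B where B: "\<And>s. s \<in> J \<Longrightarrow> \<bar>s\<bar> \<le> B" using bdd by (auto simp: bounded_iff)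
  define \<sigma> where "\<sigma> t = (SUP s\<in>J. s * t)" for t
  have ne: "J \<noteq> {}" using sub \<omega> by auto
  have upper: "s * t \<le> B * \<bar>t\<bar>" if "s \<in> J" for s t
  proof -
    have "s * t \<le> \<bar>s\<bar> * \<bar>t\<bar>" by (simp flip: abs_mult)
    also have "\<dots> \<le> B * \<bar>t\<bar>" using B that by (intro mult_right_mono) auto
    finally show ?thesis .
  qed
  then have bdd_above: "bdd_above ((\<lambda>s. s * t) ` J)" for t by (auto simp: bdd_above_def)
  have le_\<sigma>: "s * t \<le> \<sigma> t" if "s \<in> J" for s t
    unfolding \<sigma>_def by (rule cSUP_upper[OF that bdd_above])
  have \<sigma>_le: "\<sigma> t \<le> M" if "\<And>s. s \<in> J \<Longrightarrow> s * t \<le> M" for t M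
    unfolding \<sigma>_def by (rule cSUP_least[OF ne that])
  show ?thesis
  proof (rule that)
    show "support_function J t = ereal (\<sigma> t)" for t
      unfolding support_function_def
    proof (rule antisym)
      show "(SUP s\<in>J. ereal (s * t)) \<le> ereal (\<sigma> t)" by (rule SUP_least) (simp add: le_\<sigma>)
      obtain s0 where s0: "s0 \<in> J" using ne by blast
      show "ereal (\<sigma> t) \<le> (SUP s\<in>J. ereal (s * t))"
      proof (cases "SUP s\<in>J. ereal (s * t)")
        case (real M)
        have "s * t \<le> M" if "s \<in> J" for s
          using SUP_upper[OF that, of "\<lambda>s. ereal (s * t)"] real by simp
        then show ?thesis using \<sigma>_le real by simp
      next
        case MInf
        then show ?thesis using SUP_upper[OF s0, of "\<lambda>s. ereal (s * t)"] by simp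
      qed simp
    qed
    show "convex_on UNIV \<sigma>"
    proof (rule convex_onI)
      fix \<tau> a b :: real assume \<tau>: "0 < \<tau>" "\<tau> < 1"
      show "\<sigma> ((1 - \<tau>) *\<^sub>R a + \<tau> *\<^sub>R b) \<le> (1 - \<tau>) * \<sigma> a + \<tau> * \<sigma> b"
      proof (rule \<sigma>_le)
        fix s assume s: "s \<in> J"
        have "s * ((1 - \<tau>) *\<^sub>R a + \<tau> *\<^sub>R b) = (1 - \<tau>) * (s * a) + \<tau> * (s * b)"
          by (simp add: algebra_simps)
        also have "\<dots> \<le> (1 - \<tau>) * \<sigma> a + \<tau> * \<sigma> b"
          using \<tau> le_\<sigma>[OF s] by (intro add_mono mult_left_mono) auto
        finally show "s * ((1 - \<tau>) *\<^sub>R a + \<tau> *\<^sub>R b) \<le> (1 - \<tau>) * \<sigma> a + \<tau> * \<sigma> b" .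
      qed
    qed simp
    have "\<omega> \<in> J" "- \<omega> \<in> J" using sub \<omega> by (auto simp: subset_iff)
    then show "\<omega> * \<bar>t\<bar> \<le> \<sigma> t" for t
      using le_\<sigma>[of \<omega> t] le_\<sigma>[of "- \<omega>" t] by (cases "0 \<le> t") auto
    have "\<sigma> 0 \<le> 0" by (rule \<sigma>_le) simp
    moreover have "0 \<le> \<sigma> 0" using ne le_\<sigma>[of _ 0] by auto
    ultimately show "\<sigma> 0 = 0" by simp
  qed
qed

context sparse_penalty
begin

text \<open>
  The two extended-real sums are finite together exactly when the sum of the \<open>\<phi> k\<close> converges, because all
  terms are nonnegative.
\<close>
lemma ereal_penalty_eq:
  assumes supp: "\<And>k t. k \<in> N \<Longrightarrow> support_function (I k) t = ereal (\<sigma> k t)"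
  shows "weighted_l1 N e I z + ereal (1 / p) * lp_norm_powr N e p z
      = (if z \<in> dom_G then ereal (G z) else \<infinity>)"
proof -
  let ?s = "\<lambda>k. \<sigma> k (z \<bullet> e k)" and ?t = "\<lambda>k. \<bar>z \<bullet> e k\<bar> powr p"
  have s_nonneg: "0 \<le> ?s k" if "k \<in> N" for k
    using \<sigma>_ge[OF that, of "z \<bullet> e k"] \<omega> by (meson abs_ge_zero mult_nonneg_nonneg order_less_imp_le order_trans)
  have l1: "weighted_l1 N e I z = (if ?s summable_on N then ereal (\<Sum>\<^sub>\<infinity>k\<in>N. ?s k) else \<infinity>)"
    unfolding weighted_l1_def
    by (subst infsum_ereal_nonneg[symmetric]) (auto intro!: infsum_cong simp: supp s_nonneg)
  have lp: "lp_norm_powr N e p z = (if ?t summable_on N then ereal (\<Sum>\<^sub>\<infinity>k\<in>N. ?t k) else \<infinity>)"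
    unfolding lp_norm_powr_def by (rule infsum_ereal_nonneg) simp
  have t_iff: "(\<lambda>k. ?t k / p) summable_on N \<longleftrightarrow> ?t summable_on N"
    using summable_on_cmult_left'[of "1 / p" ?t N] p by simp
  have dom: "z \<in> dom_G \<longleftrightarrow> ?s summable_on N \<and> ?t summable_on N"
  proof
    assume "z \<in> dom_G"
    then have *: "(\<lambda>k. \<phi> k (z \<bullet> e k)) summable_on N" by (simp add: dom_G_def)
    have "?s summable_on N" "(\<lambda>k. ?t k / p) summable_on N"
      using summable_on_comparison_test[OF *] s_nonneg p by (auto simp: \<phi>_def)
    then show "?s summable_on N \<and> ?t summable_on N" using t_iff by simp
  next
    assume "?s summable_on N \<and> ?t summable_on N"
    then show "z \<in> dom_G" using t_iff unfolding dom_G_def \<phi>_def by (simp add: summable_on_add)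
  qed
  have "G z = (\<Sum>\<^sub>\<infinity>k\<in>N. ?s k) + (\<Sum>\<^sub>\<infinity>k\<in>N. ?t k) / p" if "z \<in> dom_G"
  proof -
    have "G z = (\<Sum>\<^sub>\<infinity>k\<in>N. ?s k) + (\<Sum>\<^sub>\<infinity>k\<in>N. ?t k / p)"
      unfolding G_def \<phi>_def using that dom t_iff by (intro infsum_add) auto
    also have "(\<Sum>\<^sub>\<infinity>k\<in>N. ?t k / p) = (\<Sum>\<^sub>\<infinity>k\<in>N. ?t k) / p"
      using infsum_cmult_left'[of ?t "1 / p" N] by simp
    finally show ?thesis .
  qed
  then show ?thesis using p unfolding l1 lp dom by auto
qed

lemma minimizer_exists:
  assumes H_nonneg: "\<And>z. 0 \<le> H z" and H_cont: "continuous_on UNIV H"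
    and H_mid: "\<And>x u. H ((1/2) *\<^sub>R (x + u)) \<le> (H x + H u) / 2"
  shows "\<exists>!z. z \<in> dom_G \<and> (\<forall>u\<in>dom_G. G z + H z \<le> G u + H u)"
proof -
  obtain q where q: "0 < q" "uniformly_midconvex dom_G G q"
  proof (cases "p \<le> 2")
    case True
    then show ?thesis using that[of 2] uniformly_midconvex_G_le2 by simp
  next
    case False
    then show ?thesis using that[of "2 * (p - 1)"] uniformly_midconvex_G_ge2 by simp
  qed
  have conv: "uniformly_midconvex dom_G (\<lambda>z. G z + H z) q"
    by (rule uniformly_midconvex_add[OF q(2) H_nonneg H_mid])
  have "\<exists>z\<in>dom_G. \<forall>u\<in>dom_G. G z + H z \<le> G u + H u"
  proof (rule uniformly_midconvex_minimizer_exists[OF _ _ conv q(1)])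
    show "dom_G \<noteq> {}" using zero_in_dom_G by auto
    show "0 \<le> G z + H z" if "z \<in> dom_G" for z using G_nonneg[OF that] H_nonneg[of z] by simp
    show "closed {z \<in> dom_G. G z + H z \<le> M}" for M
      by (rule closed_sublevel_add[OF closed_sublevel_G H_cont])
  qed
  then show ?thesis using uniformly_midconvex_minimizer_unique[OF conv] by blast
qed

text \<open>
  The definite description in \<open>prox\<close> denotes a minimizer because the proximal problem has exactly one.
\<close>
lemma prox_minimizes:
  fixes v :: 'a
  assumes lam: "0 < lam"
  defines "z \<equiv> prox lam (\<lambda>z. if z \<in> dom_G then ereal (G z) else \<infinity>) v"
  shows "z \<in> dom_G"
    and "u \<in> dom_G \<Longrightarrow>
      G z + 1 / (2 * lam) * (norm (z - v))\<^sup>2 \<le> G u + 1 / (2 * lam) * (norm (u - v))\<^sup>2"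
proof -
  define H where "H u = 1 / (2 * lam) * (norm (u - v))\<^sup>2" for u
  have mid: "H ((1/2) *\<^sub>R (x + u)) \<le> (H x + H u) / 2" for x u
  proof -
    have "(norm ((1/2) *\<^sub>R (x + u) - v))\<^sup>2 \<le> ((norm (x - v))\<^sup>2 + (norm (u - v))\<^sup>2) / 2"
      by (rule norm_midpoint_diff_sq_le)
    then have "1 / (2 * lam) * (norm ((1/2) *\<^sub>R (x + u) - v))\<^sup>2
        \<le> 1 / (2 * lam) * (((norm (x - v))\<^sup>2 + (norm (u - v))\<^sup>2) / 2)"
      using lam by (intro mult_left_mono) auto
    also have "\<dots> = (H x + H u) / 2" unfolding H_def by (simp add: add_divide_distrib)
    finally show ?thesis by (simp only: H_def)
  qed
  have ex1: "\<exists>!z. z \<in> dom_G \<and> (\<forall>u\<in>dom_G. G z + H z \<le> G u + H u)"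
    using lam by (intro minimizer_exists mid) (auto simp: H_def intro!: continuous_intros)
  have "(\<lambda>u. (if u \<in> dom_G then ereal (G u) else \<infinity>) + ereal (H u))
      = (\<lambda>u. if u \<in> dom_G then ereal (G u + H u) else \<infinity>)" by auto
  moreover have "dom_G \<noteq> {}" using zero_in_dom_G by auto
  ultimately have "z = (THE z. z \<in> dom_G \<and> (\<forall>u\<in>dom_G. G z + H z \<le> G u + H u))"
    unfolding z_def prox_def H_def[symmetric] by (simp add: argmin_extension)
  then have "z \<in> dom_G \<and> (\<forall>u\<in>dom_G. G z + H z \<le> G u + H u)"
    using theI'[OF ex1] by simp
  then show "z \<in> dom_G" and "u \<in> dom_G \<Longrightarrow>
      G z + 1 / (2 * lam) * (norm (z - v))\<^sup>2 \<le> G u + 1 / (2 * lam) * (norm (u - v))\<^sup>2"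
    by (auto simp: H_def)
qed

section \<open>Convergence and rates for sparse penalties\<close>

lemma rates_le2:
  assumes fb: "forward_backward dom_G G H D L lam x xbar"
    and H_nonneg: "\<And>z. 0 \<le> H z" and H_mid: "\<And>x u. H ((1/2) *\<^sub>R (x + u)) \<le> (H x + H u) / 2"
    and p2: "p \<le> 2"
  obtains \<epsilon> C where "0 < \<epsilon>" "\<epsilon> < 1" "0 < C"
    "\<And>n. x n \<in> dom_G \<Longrightarrow>
      (G (x (Suc n)) + H (x (Suc n))) - (G xbar + H xbar) \<le> \<epsilon> * ((G (x n) + H (x n)) - (G xbar + H xbar))"
    "\<And>n. norm (x (Suc n) - xbar) \<le> C * sqrt \<epsilon> ^ n"
proof -
  interpret fb: forward_backward dom_G G H D L lam x xbar by fact
  obtain c where c: "0 < c" "\<And>u. u \<in> dom_G \<Longrightarrow> G u + H u \<le> G (x 1) + H (x 1) \<Longrightarrow>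
      c * norm (u - xbar) powr 2 \<le> G u + H u - (G xbar + H xbar)"
    using uniformly_midconvex_growth[OF uniformly_midconvex_add[OF uniformly_midconvex_G_le2[OF p2]
        H_nonneg H_mid] fb.xbar_in fb.xbar_min, of "G (x 1) + H (x 1)"] by blast
  have "c * norm (x n - xbar) powr 2 \<le> fb.gap n" if "1 \<le> n" for n
    unfolding fb.gap_def using c(2) fb.x_in[OF that] fb.objective_le_first[OF that] by blast
  from fb.linear_rate[OF c(1) this] show ?thesis
    using that unfolding fb.gap_def by blast
qed

text \<open>
  The set \<open>S\<close> is either the whole domain or the subspace of vectors with prescribed finite support that
  eventually contains the iterates; the exponent \<open>q\<close> depends on this choice.
\<close>
lemma polynomial_rates_of_growth:
  assumes fb: "forward_backward dom_G G H D L lam x xbar"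
    and H_nonneg: "\<And>z. 0 \<le> H z" and H_mid: "\<And>x u. H ((1/2) *\<^sub>R (x + u)) \<le> (H x + H u) / 2"
    and q: "2 < q" and conv: "uniformly_midconvex S G q" and S: "S \<subseteq> dom_G" "xbar \<in> S"
    and n0: "1 \<le> n0" "\<And>n. n0 \<le> n \<Longrightarrow> x n \<in> S"
  obtains C1 C2 where "0 < C1" "0 < C2"
    "\<And>n. 1 \<le> n \<Longrightarrow> (G (x n) + H (x n)) - (G xbar + H xbar) \<le> C1 * real n powr (- (q / (q - 2)))"
    "\<And>n. 1 \<le> n \<Longrightarrow> norm (x (Suc n) - xbar) \<le> C2 * real n powr (- (1 / (q - 2)))"
proof -
  interpret fb: forward_backward dom_G G H D L lam x xbar by fact
  have min: "G xbar + H xbar \<le> G u + H u" if "u \<in> S" for u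
    using fb.xbar_min that S by blast
  obtain c where c: "0 < c" "\<And>u. u \<in> S \<Longrightarrow> G u + H u \<le> G (x 1) + H (x 1) \<Longrightarrow>
      c * norm (u - xbar) powr q \<le> G u + H u - (G xbar + H xbar)"
    using uniformly_midconvex_growth[OF uniformly_midconvex_add[OF conv
        H_nonneg H_mid] S(2) min, of "G (x 1) + H (x 1)"] by blast
  have "c * norm (x n - xbar) powr q \<le> fb.gap n" if "n0 \<le> n" for n
    unfolding fb.gap_def using c(2) n0(2)[OF that] fb.objective_le_first[of n] that n0(1) by simp
  from fb.polynomial_rates[OF c(1) q n0(1) this] show ?thesis
    using that unfolding fb.gap_def by blast
qed

text \<open>
  For \<open>p > 2\<close> the exponent \<open>2 * (p - 1)\<close>, valid on the whole domain, is good enough for convergence.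
\<close>
lemma iterates_converge:
  assumes fb: "forward_backward dom_G G H D L lam x xbar"
    and H_nonneg: "\<And>z. 0 \<le> H z" and H_mid: "\<And>x u. H ((1/2) *\<^sub>R (x + u)) \<le> (H x + H u) / 2"
  shows "x \<longlonglongrightarrow> xbar"
proof -
  interpret fb: forward_backward dom_G G H D L lam x xbar by fact
  have "(\<lambda>n. x (Suc n) - xbar) \<longlonglongrightarrow> 0"
  proof (cases "p \<le> 2")
    case True
    obtain \<epsilon> C where \<epsilon>: "0 < \<epsilon>" "\<epsilon> < 1" and C: "\<And>n. norm (x (Suc n) - xbar) \<le> C * sqrt \<epsilon> ^ n"
      using rates_le2[OF fb H_nonneg H_mid True] by metis
    have "(\<lambda>n. C * sqrt \<epsilon> ^ n) \<longlonglongrightarrow> C * 0"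
      using \<epsilon> by (intro tendsto_intros LIMSEQ_power_zero) simp
    then have "(\<lambda>n. C * sqrt \<epsilon> ^ n) \<longlonglongrightarrow> 0" by simp
    moreover have "eventually (\<lambda>n. norm (x (Suc n) - xbar) \<le> C * sqrt \<epsilon> ^ n) sequentially"
      by (rule always_eventually) (use C in blast)
    ultimately show ?thesis by (rule Lim_null_comparison[rotated])
  next
    case False
    then have q: "2 < 2 * (p - 1)" and p2: "2 \<le> p" by simp_all
    obtain C where C: "\<And>n. 1 \<le> n \<Longrightarrow>
        norm (x (Suc n) - xbar) \<le> C * real n powr (- (1 / (2 * (p - 1) - 2)))"
      by (rule polynomial_rates_of_growth[OF fb H_nonneg H_mid q uniformly_midconvex_G_ge2[OF p2]
          order_refl fb.xbar_in order_refl fb.x_in]) (assumption, rule that)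
    have "(\<lambda>n. real n powr (- (1 / (2 * (p - 1) - 2)))) \<longlonglongrightarrow> 0"
      using False by (intro tendsto_neg_powr filterlim_real_sequentially) auto
    then have "(\<lambda>n. C * real n powr (- (1 / (2 * (p - 1) - 2)))) \<longlonglongrightarrow> 0"
      by (rule tendsto_mult_right_zero)
    moreover have "eventually (\<lambda>n. norm (x (Suc n) - xbar)
        \<le> C * real n powr (- (1 / (2 * (p - 1) - 2)))) sequentially"
      using eventually_ge_at_top[of 1] by (rule eventually_mono) (rule C)
    ultimately show ?thesis by (rule Lim_null_comparison[rotated])
  qed
  then have "(\<lambda>n. x (Suc n)) \<longlonglongrightarrow> xbar" by (simp add: LIM_zero_iff)
  then show ?thesis by (rule LIMSEQ_imp_Suc)
qed

text \<open>
  The points \<open>v n\<close> at which the proximal map is evaluated converge strongly, and their limit has only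
  finitely many coordinates above half of the threshold \<open>lam * \<omega>\<close>.  Eventually \<open>v n\<close> is within the other
  half of the limit, so the proximal map annihilates all remaining coordinates.
\<close>
lemma finite_support_identification:
  assumes fb: "forward_backward dom_G G H D L lam x xbar" and lim: "x \<longlonglongrightarrow> xbar"
  obtains K n0 where "finite K" "1 \<le> n0" "\<And>n k. n0 \<le> n \<Longrightarrow> k \<in> N - K \<Longrightarrow> x n \<bullet> e k = 0"
    "\<And>k. k \<in> N - K \<Longrightarrow> xbar \<bullet> e k = 0"
proof -
  interpret fb: forward_backward dom_G G H D L lam x xbar by fact
  define v where "v n = x n - lam *\<^sub>R D (x n)" for n
  define vbar where "vbar = xbar - lam *\<^sub>R D xbar"
  have "L-lipschitz_on UNIV D"
    using fb.D_lipschitz fb.L by (auto simp: lipschitz_on_def dist_norm)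
  then have "continuous_on UNIV D" by (rule lipschitz_on_continuous_on)
  then have "(\<lambda>n. D (x n)) \<longlonglongrightarrow> D xbar" using continuous_on_tendsto_compose[OF _ lim, of UNIV D] by simp
  then have "v \<longlonglongrightarrow> vbar" unfolding v_def [abs_def] vbar_def by (intro tendsto_intros lim)
  moreover have half: "0 < lam * \<omega> / 2" using fb.lam \<omega> by simp
  ultimately obtain n1 where n1: "\<And>n. n1 \<le> n \<Longrightarrow> norm (v n - vbar) < lam * \<omega> / 2"
    by (meson LIMSEQ_D)
  define K where "K = {k \<in> N. lam * \<omega> / 2 \<le> \<bar>vbar \<bullet> e k\<bar>}"
  have zero: "x n \<bullet> e k = 0" if "Suc n1 \<le> n" "k \<in> N - K" for n k
  proof -
    obtain m where m: "n = Suc m" "n1 \<le> m" using \<open>Suc n1 \<le> n\<close> by (cases n) auto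
    have "\<bar>v m \<bullet> e k\<bar> = \<bar>vbar \<bullet> e k + (v m - vbar) \<bullet> e k\<bar>" by (simp add: inner_diff_left)
    also have "\<dots> \<le> \<bar>vbar \<bullet> e k\<bar> + \<bar>(v m - vbar) \<bullet> e k\<bar>" by simp
    also have "\<bar>(v m - vbar) \<bullet> e k\<bar> \<le> norm (v m - vbar)"
      using Cauchy_Schwarz_ineq2[of "v m - vbar" "e k"] that by (simp add: norm_basis)
    finally have "\<bar>v m \<bullet> e k\<bar> \<le> \<bar>vbar \<bullet> e k\<bar> + norm (v m - vbar)" by simp
    moreover have "\<bar>vbar \<bullet> e k\<bar> < lam * \<omega> / 2" using that by (auto simp: K_def)
    ultimately have "\<bar>v m \<bullet> e k\<bar> \<le> lam * \<omega>" using n1[OF m(2)] by linarith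
    then show ?thesis unfolding m(1)
      using that fb.step_in fb.step_min fb.lam
      by (intro prox_coordinate_zero[of _ lam k "v m"]) (auto simp: v_def)
  qed
  have "xbar \<bullet> e k = 0" if "k \<in> N - K" for k
  proof -
    have "(\<lambda>n. x n \<bullet> e k) \<longlonglongrightarrow> xbar \<bullet> e k" by (intro tendsto_intros lim)
    moreover have "(\<lambda>n. x n \<bullet> e k) \<longlonglongrightarrow> 0"
    proof (rule tendsto_eventually)
      show "eventually (\<lambda>n. x n \<bullet> e k = 0) sequentially"
        using eventually_ge_at_top[of "Suc n1"] by (rule eventually_mono) (rule zero[OF _ that])
    qed
    ultimately show ?thesis by (rule LIMSEQ_unique)
  qed
  moreover have "finite K" unfolding K_def by (rule finite_large_coordinates[OF half])
  ultimately show ?thesis using that[of K "Suc n1"] zero by simp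
qed

text \<open>
  Strong convergence, obtained first with the exponent \<open>2 * (p - 1)\<close>, confines the iterates to finitely many
  coordinates from some index on, where growth holds with the exponent \<open>p\<close>.
\<close>
lemma rates_gt2:
  assumes fb: "forward_backward dom_G G H D L lam x xbar"
    and H_nonneg: "\<And>z. 0 \<le> H z" and H_mid: "\<And>x u. H ((1/2) *\<^sub>R (x + u)) \<le> (H x + H u) / 2"
    and p2: "2 < p"
  obtains C1 C2 where "0 < C1" "0 < C2"
    "\<And>n. 1 \<le> n \<Longrightarrow> (G (x n) + H (x n)) - (G xbar + H xbar) \<le> C1 * real n powr (- (p / (p - 2)))"
    "\<And>n. 1 \<le> n \<Longrightarrow> norm (x (Suc n) - xbar) \<le> C2 * real n powr (- (1 / (p - 2)))"
proof -
  interpret fb: forward_backward dom_G G H D L lam x xbar by fact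
  obtain K n0 where K: "finite K" "1 \<le> n0" "\<And>n k. n0 \<le> n \<Longrightarrow> k \<in> N - K \<Longrightarrow> x n \<bullet> e k = 0"
    "\<And>k. k \<in> N - K \<Longrightarrow> xbar \<bullet> e k = 0"
    using finite_support_identification[OF fb iterates_converge[OF fb H_nonneg H_mid]] by blast
  have conv: "uniformly_midconvex {z \<in> dom_G. \<forall>k\<in>N - K. z \<bullet> e k = 0} G p"
    using p2 K(1) by (intro uniformly_midconvex_G_finite_support) auto
  have xbar: "xbar \<in> {z \<in> dom_G. \<forall>k\<in>N - K. z \<bullet> e k = 0}"
    using K(4) fb.xbar_in by simp
  have x: "x n \<in> {z \<in> dom_G. \<forall>k\<in>N - K. z \<bullet> e k = 0}" if "n0 \<le> n" for n
    using K(2) K(3)[OF that] that fb.x_in[of n] by simp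
  show ?thesis
    by (rule polynomial_rates_of_growth[OF fb H_nonneg H_mid p2 conv Collect_restrict xbar K(2) x])
      (assumption, rule that)
qed

end

section \<open>Convergence and rates for the regularized least-squares problem\<close>

lemma least_squares_expansion:
  fixes A :: "'a::{real_inner, complete_space} \<Rightarrow> 'b::real_inner" and y :: 'b
  assumes A: "bounded_linear A"
  defines "h \<equiv> (\<lambda>z. 1 / 2 * (norm (A z - y))\<^sup>2)"
  shows "h u = h z + gradient h z \<bullet> (u - z) + 1 / 2 * (norm (A (u - z)))\<^sup>2"
proof -
  interpret bounded_linear A by fact
  have "A u - y = (A z - y) + A (u - z)" by (simp add: diff)
  then have "(norm (A u - y))\<^sup>2
      = (norm (A z - y))\<^sup>2 + 2 * ((A z - y) \<bullet> A (u - z)) + (norm (A (u - z)))\<^sup>2"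
    by (simp only: power2_norm_eq_inner inner_add_left inner_add_right inner_commute)
  then show ?thesis unfolding h_def inner_gradient_least_squares[OF A] by simp
qed

text \<open>
  The gradient of the least-squares functional is affine with the linear part determined by the quadratic
  form \<open>(norm (A w))\<^sup>2\<close>, so its Lipschitz constant bounds this form.  Since a quadratic functional equals its
  second-order expansion, this is all that the descent lemma asks for.
\<close>
lemma norm_le_of_gradient_lipschitz:
  fixes A :: "'a::{real_inner, complete_space} \<Rightarrow> 'b::real_inner"
  assumes A: "bounded_linear A"
    and lip: "L-lipschitz_on UNIV (gradient (\<lambda>z. 1 / 2 * (norm (A z - y))\<^sup>2))"
  shows "(norm (A w))\<^sup>2 \<le> L * (norm w)\<^sup>2"
proof -
  interpret bounded_linear A by fact
  let ?D = "gradient (\<lambda>z. 1 / 2 * (norm (A z - y))\<^sup>2)"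
  have "(norm (A w))\<^sup>2 = (?D w - ?D 0) \<bullet> w"
    unfolding inner_diff_left inner_gradient_least_squares[OF A]
    by (simp add: zero power2_norm_eq_inner inner_diff_left)
  also have "\<dots> \<le> norm (?D w - ?D 0) * norm w" by (rule norm_cauchy_schwarz)
  also have "norm (?D w - ?D 0) \<le> L * norm w"
    using lipschitz_onD[OF lip, of w 0] by (simp add: dist_norm)
  finally show ?thesis by (simp add: mult_right_mono power2_eq_square mult.assoc)
qed

theorem theorem4p11:
  fixes N :: "nat set"
    and e :: "nat \<Rightarrow> 'a::{real_inner, polish_space}"
    and p :: real
    and y :: "'b::{real_inner, polish_space}"
    and A :: "'a \<Rightarrow> 'b"
    and I :: "nat \<Rightarrow> real set"
    and h :: "'a \<Rightarrow> real"
    and g f :: "'a \<Rightarrow> ereal"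
    and L lam :: real
    and x :: "nat \<Rightarrow> 'a"
  defines "h \<equiv> (\<lambda>z. 1 / 2 * (norm (A z - y))\<^sup>2)"
    and "g \<equiv> (\<lambda>z. weighted_l1 N e I z + ereal (1 / p) * lp_norm_powr N e p z)"
    and "f \<equiv> (\<lambda>z. g z + ereal (h z))"
  assumes "orthonormal_basis N e"
    and "1 < p"
    and "bounded_linear A"
    and "\<And>k. k \<in> N \<Longrightarrow> is_interval (I k) \<and> closed (I k) \<and> bounded (I k)"
    and "\<exists>\<omega>>0. \<forall>k\<in>N. {-\<omega>..\<omega>} \<subseteq> I k"
    and "0 < L"
    and "L-lipschitz_on UNIV (gradient h)"
    and "0 < lam" and "lam < 2 / L"
    and "\<And>n. x (Suc n) = prox lam g (x n - lam *\<^sub>R gradient h (x n))"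
  shows "\<exists>xbar \<in> argmin f.
    x \<longlonglongrightarrow> xbar \<and>
    (p < 2 \<longrightarrow> (\<exists>\<epsilon> C :: real. 0 < \<epsilon> \<and> \<epsilon> < 1 \<and> 0 < C \<and>
      (\<forall>n\<ge>1. f (x n) - (INF z. f z) \<le> ereal (\<epsilon> ^ n) * (f (x 0) - (INF z. f z)) \<and>
             norm (x (Suc n) - xbar) \<le> C * sqrt \<epsilon> ^ n))) \<and>
    (2 < p \<longrightarrow> (\<exists>C\<^sub>1 C\<^sub>2 :: real. 0 < C\<^sub>1 \<and> 0 < C\<^sub>2 \<and>
      (\<forall>n\<ge>1. f (x n) - (INF z. f z) \<le> ereal (C\<^sub>1 * real n powr (- (p / (p - 2)))) \<and>
             norm (x (Suc n) - xbar) \<le> C\<^sub>2 * real n powr (- (1 / (p - 2))))))"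
proof -
  have basis: "orthonormal_basis N e" and p: "1 < p" and A: "bounded_linear A"
    and I: "\<And>k. k \<in> N \<Longrightarrow> is_interval (I k) \<and> closed (I k) \<and> bounded (I k)"
    and L: "0 < L" and lip: "L-lipschitz_on UNIV (gradient h)" and lam: "0 < lam" "lam < 2 / L"
    and step: "\<And>n. x (Suc n) = prox lam g (x n - lam *\<^sub>R gradient h (x n))"
    by fact+
  obtain \<omega> where \<omega>: "0 < \<omega>" "\<And>k. k \<in> N \<Longrightarrow> {-\<omega>..\<omega>} \<subseteq> I k"
    using \<open>\<exists>\<omega>>0. \<forall>k\<in>N. {-\<omega>..\<omega>} \<subseteq> I k\<close> by blast
  have "\<exists>s. (\<forall>t. support_function (I k) t = ereal (s t)) \<and> convex_on UNIV s \<and>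
      (\<forall>t. \<omega> * \<bar>t\<bar> \<le> s t) \<and> s 0 = 0" if "k \<in> N" for k
    using support_function_interval[OF \<omega>(1) \<omega>(2)[OF that]] I[OF that] by metis
  then obtain \<sigma> where \<sigma>: "\<And>k t. k \<in> N \<Longrightarrow> support_function (I k) t = ereal (\<sigma> k t)"
    "\<And>k. k \<in> N \<Longrightarrow> convex_on UNIV (\<sigma> k)" "\<And>k t. k \<in> N \<Longrightarrow> \<omega> * \<bar>t\<bar> \<le> \<sigma> k t"
    "\<And>k. k \<in> N \<Longrightarrow> \<sigma> k 0 = 0" by metis
  interpret sparse_penalty N e \<sigma> \<omega> p
    by unfold_locales (use basis p \<omega> \<sigma> in auto)
  have g_eq: "g = (\<lambda>z. if z \<in> dom_G then ereal (G z) else \<infinity>)"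
    unfolding g_def using ereal_penalty_eq[of I] \<sigma>(1) by auto
  have f_eq: "f = (\<lambda>z. if z \<in> dom_G then ereal (G z + h z) else \<infinity>)"
    unfolding f_def g_eq by auto
  have dom_ne: "dom_G \<noteq> {}" using zero_in_dom_G by auto
  have h_nonneg: "0 \<le> h z" for z by (simp add: h_def)
  have h_cont: "continuous_on UNIV h"
    unfolding h_def by (intro continuous_intros linear_continuous_on A)
  have h_mid: "h ((1/2) *\<^sub>R (z + u)) \<le> (h z + h u) / 2" for z u
  proof -
    interpret bounded_linear A by fact
    have "A ((1/2) *\<^sub>R (z + u)) = (1/2) *\<^sub>R (A z + A u)" by (simp only: scaleR add)
    then show ?thesis using norm_midpoint_diff_sq_le[of "A z" "A u" y] by (simp add: h_def)
  qed
  obtain xbar where xbar: "xbar \<in> dom_G" "\<And>u. u \<in> dom_G \<Longrightarrow> G xbar + h xbar \<le> G u + h u"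
    using minimizer_exists[of h, OF h_nonneg h_cont h_mid] by blast
  have fb: "forward_backward dom_G G h (gradient h) L lam x xbar"
  proof
    have expand: "h u = h z + gradient h z \<bullet> (u - z) + 1 / 2 * (norm (A (u - z)))\<^sup>2" for u z
      unfolding h_def by (rule least_squares_expansion[OF A])
    show "h z + gradient h z \<bullet> (u - z) \<le> h u" for z u
      using expand[of u z] by simp
    show "h u \<le> h z + gradient h z \<bullet> (u - z) + L / 2 * (norm (u - z))\<^sup>2" for z u
      using expand[of u z] norm_le_of_gradient_lipschitz[OF A lip[unfolded h_def], of "u - z"] by simp
    show "norm (gradient h z - gradient h u) \<le> L * norm (z - u)" for z u
      using lipschitz_onD[OF lip, of z u] by (simp add: dist_norm)
    show "x (Suc n) \<in> dom_G" for n
      unfolding step g_eq by (rule prox_minimizes[OF lam(1)])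
    show "G (x (Suc n)) + 1 / (2 * lam) * (norm (x (Suc n) - (x n - lam *\<^sub>R gradient h (x n))))\<^sup>2
        \<le> G u + 1 / (2 * lam) * (norm (u - (x n - lam *\<^sub>R gradient h (x n))))\<^sup>2"
      if "u \<in> dom_G" for u n
      unfolding step g_eq by (rule prox_minimizes(2)[OF lam(1) that])
  qed (use G_convex L lam xbar in auto)
  interpret fb: forward_backward dom_G G h "gradient h" L lam x xbar by fact
  have f_dom: "f z = ereal (G z + h z)" if "z \<in> dom_G" for z using that by (simp add: f_eq)
  have inf: "(INF z. f z) = ereal (G xbar + h xbar)"
  proof (rule antisym)
    show "(INF z. f z) \<le> ereal (G xbar + h xbar)"
      using INF_lower[of xbar UNIV f] f_dom[OF xbar(1)] by simp
    show "ereal (G xbar + h xbar) \<le> (INF z. f z)"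
      by (rule INF_greatest) (simp add: f_eq xbar(2))
  qed
  have gap: "f (x n) - (INF z. f z) = ereal ((G (x n) + h (x n)) - (G xbar + h xbar))"
    if "x n \<in> dom_G" for n
    unfolding inf f_dom[OF that] by simp
  show ?thesis
  proof (intro bexI conjI impI)
    show "xbar \<in> argmin f"
      unfolding f_eq argmin_extension[OF dom_ne] using xbar by simp
    show "x \<longlonglongrightarrow> xbar" by (rule iterates_converge[OF fb h_nonneg h_mid])
  next
    assume "p < 2"
    then obtain \<epsilon> C where \<epsilon>: "0 < \<epsilon>" "\<epsilon> < 1" and C: "0 < C"
      and contr: "\<And>n. x n \<in> dom_G \<Longrightarrow> (G (x (Suc n)) + h (x (Suc n))) - (G xbar + h xbar)
        \<le> \<epsilon> * ((G (x n) + h (x n)) - (G xbar + h xbar))"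
      and dist: "\<And>n. norm (x (Suc n) - xbar) \<le> C * sqrt \<epsilon> ^ n"
      using rates_le2[OF fb h_nonneg h_mid] by (metis less_imp_le)
    have "f (x n) - (INF z. f z) \<le> ereal (\<epsilon> ^ n) * (f (x 0) - (INF z. f z))" for n
    proof (cases "x 0 \<in> dom_G")
      case True
      have x_in: "x m \<in> dom_G" for m using True fb.x_in[of m] by (cases m) auto
      have "(G (x n) + h (x n)) - (G xbar + h xbar)
          \<le> \<epsilon> ^ n * ((G (x 0) + h (x 0)) - (G xbar + h xbar))"
      proof (induction n)
        case (Suc n)
        show ?case
          using order_trans[OF contr[OF x_in] mult_left_mono[OF Suc, of \<epsilon>]] \<epsilon> by (simp add: mult.assoc)
      qed simp
      then show ?thesis unfolding gap[OF x_in] by simp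
    next
      case False
      then have "f (x 0) - (INF z. f z) = \<infinity>" unfolding inf by (simp add: f_eq)
      then show ?thesis using \<epsilon> by simp
    qed
    then show "\<exists>\<epsilon> C :: real. 0 < \<epsilon> \<and> \<epsilon> < 1 \<and> 0 < C \<and>
      (\<forall>n\<ge>1. f (x n) - (INF z. f z) \<le> ereal (\<epsilon> ^ n) * (f (x 0) - (INF z. f z)) \<and>
             norm (x (Suc n) - xbar) \<le> C * sqrt \<epsilon> ^ n)"
      using \<epsilon> C dist by blast
  next
    assume "2 < p"
    then obtain C1 C2 where C: "0 < C1" "0 < C2"
      and val: "\<And>n. 1 \<le> n \<Longrightarrow> (G (x n) + h (x n)) - (G xbar + h xbar)
        \<le> C1 * real n powr (- (p / (p - 2)))"
      and dist: "\<And>n. 1 \<le> n \<Longrightarrow> norm (x (Suc n) - xbar) \<le> C2 * real n powr (- (1 / (p - 2)))"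
      using rates_gt2[OF fb h_nonneg h_mid] by metis
    have "f (x n) - (INF z. f z) \<le> ereal (C1 * real n powr (- (p / (p - 2))))" if "1 \<le> n" for n
      unfolding gap[OF fb.x_in[OF that]] using val[OF that] by simp
    then show "\<exists>C\<^sub>1 C\<^sub>2 :: real. 0 < C\<^sub>1 \<and> 0 < C\<^sub>2 \<and>
      (\<forall>n\<ge>1. f (x n) - (INF z. f z) \<le> ereal (C\<^sub>1 * real n powr (- (p / (p - 2)))) \<and>
             norm (x (Suc n) - xbar) \<le> C\<^sub>2 * real n powr (- (1 / (p - 2))))"
      using C dist by blast
  qed
qed

end
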